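(* Let $\Gamma\subset U_+$ be a non-commutative, torsion-free, complex Kleinian group such that $\lambda_{12}(\Gamma)$ and $\lambda_{23}(\Gamma)$ are torsion-free. Then $\Gamma$ can be written in the following way: $$\Gamma=\mathrm{Core}(\Gamma)\rtimes\langle\xi_1\rangle\rtimes\cdots\rtimes\langle\xi_r\rangle\rtimes\langle\eta_1\rangle\rtimes\cdots\rtimes\langle\eta_m\rangle\rtimes\langle\gamma_1\rangle\rtimes\cdots\rtimes\langle\gamma_n\rangle,$$ where $$\lambda_{23}(\Gamma)=\langle\lambda_{23}(\gamma_1),\dots,\lambda_{23}(\gamma_n)\rangle,\quad n=\mathrm{rank}(\lambda_{23}(\Gamma)),$$ $$\lambda_{12}(\mathrm{Ker}(\lambda_{23}))=\langle\lambda_{12}(\eta_1),\dots,\lambda_{12}(\eta_m)\rangle,\quad m=\mathrm{rank}(\lambda_{12}(\mathrm{Ker}(\lambda_{23}))),$$ $$\Pi(\mathrm{Ker}(\lambda_{12})\cap\mathrm{Ker}(\lambda_{23}))=\langle\Pi(\xi_1),\dots,\Pi(\xi_r)\rangle,\quad r=\mathrm{rank}(\Pi(\mathrm{Ker}(\lambda_{12})\cap\mathrm{Ker}(\lambda_{23}))).$$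
   Context: $U_+\subset\mathrm{PSL}(3,\mathbb{C})$ is the subgroup of classes of upper triangular matrices. A complex Kleinian group is a discrete subgroup of $\mathrm{PSL}(3,\mathbb{C})$ acting properly and discontinuously on some non-empty open invariant subset of $\mathbb{CP}^2$. For $[\alpha_{ij}]\in U_+$ put $\lambda_{12}([\alpha_{ij}])=\alpha_{11}\alpha_{22}^{-1}$ and $\lambda_{23}([\alpha_{ij}])=\alpha_{22}\alpha_{33}^{-1}$ (homomorphisms to $\mathbb{C}^*$), and let $\Pi:U_+\to\mathrm{PSL}(2,\mathbb{C})$ be the homomorphism sending $[\alpha_{ij}]$ to the class of its lower right block $\begin{pmatrix}\alpha_{22}&\alpha_{23}\\0&\alpha_{33}\end{pmatrix}$ (the action induced on the pencil of lines through the fixed point $e_1=[1:0:0]$). For $\Gamma\subset U_+$, $\mathrm{Ker}(\lambda_{ij})$ means $\mathrm{Ker}(\lambda_{ij})\cap\Gamma$, $\mathrm{Ker}(\Gamma)$ means $\mathrm{Ker}(\Pi)\cap\Gamma$, and $$\mathrm{Core}(\Gamma)=\mathrm{Ker}(\Gamma)\cap\mathrm{Ker}(\lambda_{12})\cap\mathrm{Ker}(\lambda_{23}).$$ Iterated semidirect products are internal and associated to the left: $((A\rtimes B)\rtimes C)\rtimes\cdots$. $\mathrm{rank}$ is the minimal number of generators. *)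

theory Defs
  imports "HOL-Analysis.Analysis" "HOL-Algebra.Coset" "HOL-Algebra.Generated_Groups"
begin

section \<open>Projective special linear groups\<close>

definition SL :: "(complex^'n^'n) monoid" where
  "SL = \<lparr>carrier = {A. det A = 1}, mult = (**), one = mat 1\<rparr>"

definition SL_scalars :: "(complex^'n^'n) set" where
  "SL_scalars = {A \<in> carrier SL. \<exists>c. A = mat c}"

text \<open>Elements of \<open>PSL\<close> are cosets, that is, sets of matrices.\<close>

definition PSL :: "(complex^'n^'n) set monoid" where
  "PSL = SL Mod SL_scalars"

text \<open>The class in \<open>PSL\<close> of a matrix with arbitrary nonzero determinant: the set of its
  scalar multiples of determinant 1.\<close>

definition PSL_class :: "complex^'n^'n \<Rightarrow> (complex^'n^'n) set" where
  "PSL_class M = {B \<in> carrier SL. \<exists>c. B = mat c ** M}"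

section \<open>Complex Kleinian groups\<close>

definition quotient_topology :: "'a topology \<Rightarrow> ('a \<Rightarrow> 'b) \<Rightarrow> 'b topology" where
  "quotient_topology X q =
     topology (\<lambda>U. U \<subseteq> q ` topspace X \<and> openin X {x \<in> topspace X. q x \<in> U})"

definition PSL_topology :: "(complex^'n^'n) set topology" where
  "PSL_topology =
     quotient_topology (top_of_set (carrier SL)) (\<lambda>A. SL_scalars #>\<^bsub>SL\<^esub> A)"

text \<open>A point of projective space is the set of its nonzero homogeneous coordinate vectors.
  With \<open>complex^3\<close> this is the complex projective plane.\<close>

definition proj_point :: "complex^'n \<Rightarrow> (complex^'n) set" where
  "proj_point v = {c *s v | c. c \<noteq> 0}"

definition CP_topology :: "(complex^'n) set topology" where
  "CP_topology = quotient_topology (top_of_set (- {0})) proj_point"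

definition PSL_act :: "(complex^'n^'n) set \<Rightarrow> (complex^'n) set \<Rightarrow> (complex^'n) set" where
  "PSL_act g p = {A *v v | A v. A \<in> g \<and> v \<in> p}"

definition properly_discontinuous_on ::
    "(complex^'n^'n) set set \<Rightarrow> (complex^'n) set set \<Rightarrow> bool" where
  "properly_discontinuous_on \<Gamma> \<Omega> \<longleftrightarrow>
     (\<forall>K. compactin CP_topology K \<and> K \<subseteq> \<Omega> \<longrightarrow>
        finite {g \<in> \<Gamma>. PSL_act g ` K \<inter> K \<noteq> {}})"

definition complex_kleinian :: "(complex^3^3) set set \<Rightarrow> bool" where
  "complex_kleinian \<Gamma> \<longleftrightarrow>
     subgroup \<Gamma> PSL \<and>
     subtopology PSL_topology \<Gamma> = discrete_topology \<Gamma> \<and>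
     (\<exists>\<Omega>. openin CP_topology \<Omega> \<and> \<Omega> \<noteq> {} \<and> (\<forall>g\<in>\<Gamma>. PSL_act g ` \<Omega> = \<Omega>) \<and>
          properly_discontinuous_on \<Gamma> \<Omega>)"

section \<open>Upper triangular classes and their characters\<close>

text \<open>In the index type \<open>3\<close> one has \<open>3 = 0 < 1 < 2\<close>, so the entries below the diagonal
  are listed explicitly.\<close>

definition U_plus :: "(complex^3^3) set set" where
  "U_plus = (\<lambda>A. SL_scalars #>\<^bsub>SL\<^esub> A) `
     {A \<in> carrier SL. A$2$1 = 0 \<and> A$3$1 = 0 \<and> A$3$2 = 0}"

definition Cstar :: "complex monoid" where
  "Cstar = \<lparr>carrier = - {0}, mult = (*), one = 1\<rparr>"

text \<open>The functions below do not depend on the chosen representative of a class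
  (see the lemmas at the end), so that the image of a class is a singleton.\<close>

definition lambda12 :: "(complex^3^3) set \<Rightarrow> complex" where
  "lambda12 g = the_elem ((\<lambda>A. A$1$1 / A$2$2) ` g)"

definition lambda23 :: "(complex^3^3) set \<Rightarrow> complex" where
  "lambda23 g = the_elem ((\<lambda>A. A$2$2 / A$3$3) ` g)"

definition lower_right_block :: "complex^3^3 \<Rightarrow> complex^2^2" where
  "lower_right_block A = vector [vector [A$2$2, A$2$3], vector [A$3$2, A$3$3]]"

definition block_hom :: "(complex^3^3) set \<Rightarrow> (complex^2^2) set" where
  "block_hom g = the_elem ((\<lambda>A. PSL_class (lower_right_block A)) ` g)"

definition Ker12 :: "(complex^3^3) set set \<Rightarrow> (complex^3^3) set set" where
  "Ker12 \<Gamma> = kernel (PSL\<lparr>carrier := \<Gamma>\<rparr>) Cstar lambda12"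

definition Ker23 :: "(complex^3^3) set set \<Rightarrow> (complex^3^3) set set" where
  "Ker23 \<Gamma> = kernel (PSL\<lparr>carrier := \<Gamma>\<rparr>) Cstar lambda23"

definition KerBlock :: "(complex^3^3) set set \<Rightarrow> (complex^3^3) set set" where
  "KerBlock \<Gamma> = kernel (PSL\<lparr>carrier := \<Gamma>\<rparr>) PSL block_hom"

definition Core :: "(complex^3^3) set set \<Rightarrow> (complex^3^3) set set" where
  "Core \<Gamma> = KerBlock \<Gamma> \<inter> Ker12 \<Gamma> \<inter> Ker23 \<Gamma>"

section \<open>Group theory\<close>

definition torsion_free :: "('a, 'b) monoid_scheme \<Rightarrow> 'a set \<Rightarrow> bool" where
  "torsion_free G H \<longleftrightarrow> (\<forall>x\<in>H. \<forall>n::nat. n > 0 \<and> x [^]\<^bsub>G\<^esub> n = \<one>\<^bsub>G\<^esub> \<longrightarrow> x = \<one>\<^bsub>G\<^esub>)"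

text \<open>Only meaningful if \<open>H\<close> is a finitely generated subgroup of \<open>G\<close>.\<close>

definition group_rank :: "('a, 'b) monoid_scheme \<Rightarrow> 'a set \<Rightarrow> nat" where
  "group_rank G H = (LEAST n. \<exists>S\<subseteq>H. finite S \<and> card S = n \<and> generate G S = H)"

definition internal_semidirect ::
    "('a, 'b) monoid_scheme \<Rightarrow> 'a set \<Rightarrow> 'a set \<Rightarrow> 'a set \<Rightarrow> bool" where
  "internal_semidirect G K N H \<longleftrightarrow>
     subgroup K G \<and> N \<lhd> G\<lparr>carrier := K\<rparr> \<and> subgroup H (G\<lparr>carrier := K\<rparr>) \<and>
     N \<inter> H = {\<one>\<^bsub>G\<^esub>} \<and> N <#>\<^bsub>G\<^esub> H = K"

text \<open>\<open>iterated_semidirect G K N [H\<^sub>1, \<dots>, H\<^sub>k]\<close>: the subgroup \<open>K\<close> of \<open>G\<close> is the internal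
  product of \<open>N, H\<^sub>1, \<dots>, H\<^sub>k\<close>, associated to the left.\<close>

fun iterated_semidirect ::
    "('a, 'b) monoid_scheme \<Rightarrow> 'a set \<Rightarrow> 'a set \<Rightarrow> 'a set list \<Rightarrow> bool" where
  "iterated_semidirect G K N [] \<longleftrightarrow> subgroup K G \<and> K = N"
| "iterated_semidirect G K N (H # Hs) \<longleftrightarrow>
     (\<exists>M. internal_semidirect G M N H \<and> iterated_semidirect G K M Hs)"

section \<open>Well-definedness\<close>

lemma quotient_map_quotient_topology: "quotient_map X (quotient_topology X q) q"
proof -
  let ?P = "\<lambda>U. U \<subseteq> q ` topspace X \<and> openin X {x \<in> topspace X. q x \<in> U}"
  have "istopology ?P"
    unfolding istopology_def
  proof (intro conjI allI impI)
    fix S T assume S: "?P S" and T: "?P T"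
    show "S \<inter> T \<subseteq> q ` topspace X" using S by blast
    have "{x \<in> topspace X. q x \<in> S \<inter> T} =
        {x \<in> topspace X. q x \<in> S} \<inter> {x \<in> topspace X. q x \<in> T}" by blast
    then show "openin X {x \<in> topspace X. q x \<in> S \<inter> T}" using S T by auto
  next
    fix \<K> assume K: "\<forall>U\<in>\<K>. ?P U"
    show "\<Union>\<K> \<subseteq> q ` topspace X" using K by blast
    have "{x \<in> topspace X. q x \<in> \<Union>\<K>} = \<Union> ((\<lambda>U. {x \<in> topspace X. q x \<in> U}) ` \<K>)" by blast
    then show "openin X {x \<in> topspace X. q x \<in> \<Union>\<K>}" using K by auto
  qed
  then have o: "openin (quotient_topology X q) U \<longleftrightarrow> ?P U" for U
    unfolding quotient_topology_def by (simp add: topology_inverse')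
  have "{x \<in> topspace X. q x \<in> q ` topspace X} = topspace X" by blast
  then have "openin (quotient_topology X q) (q ` topspace X)" unfolding o by simp
  then have "topspace (quotient_topology X q) = q ` topspace X"
    using o by (metis openin_subset openin_topspace subset_antisym)
  then show ?thesis unfolding quotient_map_def using o by auto
qed

lemma mat_mult_component: "(mat c ** A) $ i $ j = c * (A $ i $ j)"
  for A :: "complex^'n^'m"
  by (simp add: matrix_matrix_mult_def mat_def if_distrib[of "\<lambda>x. x * _"] cong: if_cong)

lemma mat_mult_commute: "mat c ** A = A ** mat c"
  for A :: "complex^'n^'n"
proof -
  have "(A ** mat c) $ i $ j = c * (A $ i $ j)" for i j
    by (simp add: matrix_matrix_mult_def mat_def if_distrib[of "\<lambda>x. _ * x"] cong: if_cong)
  then show ?thesis by (simp add: vec_eq_iff mat_mult_component)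
qed

lemma group_SL: "group (SL :: (complex^'n^'n) monoid)"
proof (rule groupI)
  fix A :: "complex^'n^'n" assume "A \<in> carrier SL"
  then have d: "det A = 1" by (simp add: SL_def)
  then have "invertible A" by (simp add: invertible_det_nz)
  then obtain B where B: "B ** A = mat 1" unfolding invertible_def by blast
  then have "det B * det A = 1" by (metis det_I det_mul)
  with d have "det B = 1" by simp
  with B show "\<exists>B\<in>carrier SL. B \<otimes>\<^bsub>SL\<^esub> A = \<one>\<^bsub>SL\<^esub>" by (auto simp: SL_def)
qed (auto simp: SL_def det_mul matrix_mul_assoc)

lemma SL_scalar_nonzero:
  assumes "mat c \<in> (SL_scalars :: (complex^'n^'n) set)"
  shows "c \<noteq> 0"
proof
  assume "c = 0"
  then have "det (mat 0 :: complex^'n^'n) = 1"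
    using assms unfolding SL_scalars_def SL_def by simp
  then show False unfolding det_0 by simp
qed

lemma normal_SL_scalars: "SL_scalars \<lhd> (SL :: (complex^'n^'n) monoid)"
proof -
  interpret group "SL :: (complex^'n^'n) monoid" by (rule group_SL)
  have mm: "mat a ** mat b = (mat (a * b) :: complex^'n^'n)" for a b
    by (simp add: vec_eq_iff mat_mult_component) (simp add: mat_def)
  have "subgroup SL_scalars (SL :: (complex^'n^'n) monoid)"
  proof (rule subgroupI)
    show "SL_scalars \<subseteq> (carrier SL :: (complex^'n^'n) set)" by (auto simp: SL_scalars_def)
    have "mat 1 \<in> (SL_scalars :: (complex^'n^'n) set)" by (auto simp: SL_scalars_def SL_def)
    then show "SL_scalars \<noteq> ({} :: (complex^'n^'n) set)" by blast
  next
    fix A :: "complex^'n^'n" assume A: "A \<in> SL_scalars"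
    then obtain c where c: "A = mat c" "A \<in> carrier SL" by (auto simp: SL_scalars_def)
    have "c \<noteq> 0" using SL_scalar_nonzero A c by blast
    then have m: "mat (inverse c) ** A = mat 1" unfolding c(1) mm by simp
    then have "det (mat (inverse c) :: complex^'n^'n) * det A = 1" by (metis det_I det_mul)
    then have "det (mat (inverse c) :: complex^'n^'n) = 1" using c by (simp add: SL_def)
    then have S: "mat (inverse c) \<in> (SL_scalars :: (complex^'n^'n) set)"
      by (auto simp: SL_scalars_def SL_def)
    moreover have "inv\<^bsub>SL\<^esub> A = mat (inverse c)"
      using inv_equality[of "mat (inverse c)" A] m c S by (auto simp: SL_def SL_scalars_def)
    ultimately show "inv\<^bsub>SL\<^esub> A \<in> SL_scalars" by simp
  next
    fix A B :: "complex^'n^'n" assume "A \<in> SL_scalars" "B \<in> SL_scalars"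
    then show "A \<otimes>\<^bsub>SL\<^esub> B \<in> SL_scalars"
      by (auto simp: SL_scalars_def SL_def det_mul) (use mm in blast)
  qed
  moreover have "A \<otimes>\<^bsub>SL\<^esub> Z \<otimes>\<^bsub>SL\<^esub> inv\<^bsub>SL\<^esub> A \<in> SL_scalars"
    if "A \<in> carrier SL" "Z \<in> SL_scalars" for A Z :: "complex^'n^'n"
  proof -
    have Zc: "Z \<in> carrier SL" using that by (simp add: SL_scalars_def)
    have "A \<otimes>\<^bsub>SL\<^esub> Z = Z \<otimes>\<^bsub>SL\<^esub> A"
      using that by (auto simp: SL_scalars_def SL_def mat_mult_commute)
    then have "A \<otimes>\<^bsub>SL\<^esub> Z \<otimes>\<^bsub>SL\<^esub> inv\<^bsub>SL\<^esub> A = Z" using that Zc by (simp add: m_assoc)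
    then show ?thesis using that by simp
  qed
  ultimately show ?thesis by (simp add: normal_inv_iff)
qed

lemma group_PSL: "group (PSL :: (complex^'n^'n) set monoid)"
  unfolding PSL_def by (rule normal.factorgroup_is_group[OF normal_SL_scalars])

lemma coset_SL_scalars:
  fixes A :: "complex^'n^'n"
  shows "SL_scalars #>\<^bsub>SL\<^esub> A = {mat c ** A | c. mat c \<in> (SL_scalars :: (complex^'n^'n) set)}"
  unfolding r_coset_def by (auto simp: SL_def SL_scalars_def)

lemma mat_1_SL_scalars: "mat 1 \<in> SL_scalars"
  by (auto simp: SL_scalars_def SL_def)

lemma the_elem_coset:
  fixes A :: "complex^'n^'n"
  assumes "\<And>c. c \<noteq> 0 \<Longrightarrow> f (mat c ** A) = f A"
  shows "the_elem (f ` (SL_scalars #>\<^bsub>SL\<^esub> A)) = f A"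
proof -
  have "f ` (SL_scalars #>\<^bsub>SL\<^esub> A) = {f A}"
  proof (intro equalityI subsetI)
    fix y assume "y \<in> f ` (SL_scalars #>\<^bsub>SL\<^esub> A)"
    then obtain c where "mat c \<in> (SL_scalars :: (complex^'n^'n) set)" "y = f (mat c ** A)"
      unfolding coset_SL_scalars by auto
    then show "y \<in> {f A}" using assms SL_scalar_nonzero by auto
  next
    fix y assume "y \<in> {f A}"
    moreover have "mat 1 ** A \<in> SL_scalars #>\<^bsub>SL\<^esub> A"
      unfolding coset_SL_scalars using mat_1_SL_scalars by blast
    ultimately show "y \<in> f ` (SL_scalars #>\<^bsub>SL\<^esub> A)" by auto
  qed
  then show ?thesis by simp
qed

lemma lambda12_coset: "lambda12 (SL_scalars #>\<^bsub>SL\<^esub> A) = A$1$1 / A$2$2"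
  unfolding lambda12_def by (rule the_elem_coset) (simp add: mat_mult_component)

lemma lambda23_coset: "lambda23 (SL_scalars #>\<^bsub>SL\<^esub> A) = A$2$2 / A$3$3"
  unfolding lambda23_def by (rule the_elem_coset) (simp add: mat_mult_component)

lemma PSL_class_scale:
  assumes "c \<noteq> 0"
  shows "PSL_class (mat c ** M) = PSL_class M"
proof -
  have 1: "mat d ** (mat c ** M) = mat (d * c) ** M" for d
    by (simp add: vec_eq_iff mat_mult_component)
  have "(\<exists>d. B = mat d ** (mat c ** M)) \<longleftrightarrow> (\<exists>d. B = mat d ** M)" for B
  proof
    assume "\<exists>d. B = mat d ** M"
    then obtain d where "B = mat (d / c * c) ** M" using assms by auto
    then show "\<exists>d. B = mat d ** (mat c ** M)" unfolding 1 by blast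
  qed (auto simp: 1)
  then show ?thesis by (simp add: PSL_class_def)
qed

lemma block_hom_coset:
  "block_hom (SL_scalars #>\<^bsub>SL\<^esub> A) = PSL_class (lower_right_block A)"
  unfolding block_hom_def
proof (rule the_elem_coset)
  fix c :: complex assume "c \<noteq> 0"
  moreover have "lower_right_block (mat c ** A) = mat c ** lower_right_block A"
    by (simp add: vec_eq_iff forall_2 mat_mult_component lower_right_block_def)
  ultimately show "PSL_class (lower_right_block (mat c ** A)) = PSL_class (lower_right_block A)"
    by (simp add: PSL_class_scale)
qed

lemma PSL_class_SL:
  assumes "A \<in> carrier SL"
  shows "PSL_class A = SL_scalars #>\<^bsub>SL\<^esub> A"
  using assms unfolding coset_SL_scalars
  by (auto simp: PSL_class_def SL_scalars_def SL_def det_mul)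

end

theory Submission
  imports Defs "HOL-Algebra.FiniteProduct"
begin

text \<open>
  The heart of the matter is that \<open>\<Gamma>\<close> is finitely generated, together with all its subgroups.
  Once this is known, \<open>\<lambda>\<^sub>2\<^sub>3(\<Gamma>)\<close>, \<open>\<lambda>\<^sub>1\<^sub>2(Ker(\<lambda>\<^sub>2\<^sub>3))\<close> and \<open>\<Pi>(Ker(\<lambda>\<^sub>1\<^sub>2)\<inter>Ker(\<lambda>\<^sub>2\<^sub>3))\<close> are finitely
  generated abelian groups without torsion: the first two by hypothesis, the third because it
  consists of classes of unipotent matrices. A generating set of minimal size of such a group is
  a basis, and lifting it to the source of the homomorphism adjoins infinite cyclic factors to
  the kernel, one semidirect product at a time
  (\<open>iterated_semidirect_over_torsion_free_abelian\<close>). Doing this along the chain of kernels from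
  \<open>\<Gamma>\<close> down to \<open>Core(\<Gamma>)\<close> gives the decomposition.

  Finite generation holds for every discrete group of upper triangular matrices, although its
  image in the diagonal torus need not be discrete. Two principles replace the general theory of
  discrete subgroups of solvable Lie groups. A group with a proper homomorphism to a Euclidean
  space is finitely generated (\<open>noetherian_over_proper_map\<close>); such homomorphisms arise from
  logarithms of absolute values and from additive entries. And a linear group that preserves a
  discrete set spanning the space is itself discrete (\<open>finite_bounded_triangular_maps\<close>); if the
  discrete set spans only a line, the group acts on it by finitely many multipliers
  (\<open>finite_multipliers\<close>). For two-by-two matrices this is all that is needed: either the
  identity is the only unipotent element and the group is commutative, or the unipotent elements
  form a discrete subset of a line and a subgroup of finite index acts on it trivially, hence
  has equal eigenvalues and is commutative.

  For three-by-three matrices the discrete set consists of the unipotent elements, on which the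
  group acts by conjugation. If they do not commute, their entries next to the diagonal are
  discrete and span the plane, and the diagonal group acts on them. If they commute, their
  logarithms span a complex space of dimension at most two. In dimension two the group acts on
  it by a discrete group of triangular two-by-two matrices, whose eigenvalues determine the
  diagonal. In lower dimension, one of the characters \<open>\<lambda>\<^sub>1\<^sub>2\<close> and \<open>\<lambda>\<^sub>2\<^sub>3\<close> is trivial on a subgroup
  of finite index, or a change of coordinates leaves only the upper right entry off the diagonal
  and the group is essentially one of two-by-two matrices. A group on which \<open>\<lambda>\<^sub>1\<^sub>2\<close> is trivial
  acts by affine maps of the plane with commuting linear parts, and its translations take the
  place of the unipotent elements; the case of \<open>\<lambda>\<^sub>2\<^sub>3\<close> is dual to this.
\<close>

section \<open>Finite generation relative to a subset\<close>

text \<open>For a normal subgroup \<open>N\<close> this is the noetherian property of \<open>D / N\<close>: all subgroups are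
  finitely generated. It speaks of subgroups of \<open>D\<close> and their intersections with \<open>N\<close> so that no
  quotient group has to be formed.\<close>

definition noetherian_over :: "('a, 'b) monoid_scheme \<Rightarrow> 'a set \<Rightarrow> 'a set \<Rightarrow> bool" where
  "noetherian_over G D N \<longleftrightarrow>
     (\<forall>H. subgroup H G \<and> H \<subseteq> D \<longrightarrow>
        (\<exists>S. finite S \<and> S \<subseteq> H \<and> H \<subseteq> generate G (S \<union> (H \<inter> N))))"

lemma noetherian_overE:
  assumes "noetherian_over G D N" "subgroup H G" "H \<subseteq> D"
  obtains S where "finite S" "S \<subseteq> H" "H \<subseteq> generate G (S \<union> (H \<inter> N))"
proof -
  have "\<exists>S. finite S \<and> S \<subseteq> H \<and> H \<subseteq> generate G (S \<union> (H \<inter> N))"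
    using assms unfolding noetherian_over_def by simp
  then show thesis by (elim exE conjE) (rule that)
qed

context group
begin

lemma noetherian_over_trans:
  assumes DN: "noetherian_over G D N" and NM: "noetherian_over G N M" and N: "subgroup N G"
  shows "noetherian_over G D M"
  unfolding noetherian_over_def
proof (intro allI impI)
  fix H assume H: "subgroup H G \<and> H \<subseteq> D"
  then obtain S where S: "finite S" "S \<subseteq> H" "H \<subseteq> generate G (S \<union> (H \<inter> N))"
    using noetherian_overE[OF DN] by metis
  have HN: "subgroup (H \<inter> N) G"
    using H N by (simp add: subgroups_Inter_pair)
  obtain T where T: "finite T" "T \<subseteq> H \<inter> N" "H \<inter> N \<subseteq> generate G (T \<union> (H \<inter> N \<inter> M))"
    by (rule noetherian_overE[OF NM HN Int_lower2])
  let ?U = "S \<union> T \<union> (H \<inter> M)"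
  have Hc: "H \<subseteq> carrier G" using H subgroup.subset by blast
  have U: "?U \<subseteq> carrier G" using S T Hc by auto
  have "H \<inter> N \<subseteq> generate G ?U"
    using T(3) mono_generate[of "T \<union> (H \<inter> N \<inter> M)" ?U] by blast
  then have "S \<union> (H \<inter> N) \<subseteq> generate G ?U"
    using generate.incl[of _ ?U G] by blast
  then have "generate G (S \<union> (H \<inter> N)) \<subseteq> generate G ?U"
    by (rule generate_subgroup_incl) (rule generate_is_subgroup[OF U])
  with S(3) have "H \<subseteq> generate G ?U" by (rule subset_trans)
  moreover have "finite (S \<union> T)" "S \<union> T \<subseteq> H" using S(1,2) T(1,2) by auto
  ultimately show "\<exists>S. finite S \<and> S \<subseteq> H \<and> H \<subseteq> generate G (S \<union> (H \<inter> M))"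
    by (intro exI[of _ "S \<union> T"] conjI)
qed

lemma noetherian_over_mono:
  assumes "noetherian_over G D N" "N \<inter> D' \<subseteq> N'" "D' \<subseteq> D"
  shows "noetherian_over G D' N'"
  unfolding noetherian_over_def
proof (intro allI impI)
  fix H assume H: "subgroup H G \<and> H \<subseteq> D'"
  then have HD: "subgroup H G" "H \<subseteq> D" using assms(3) by auto
  obtain S where S: "finite S" "S \<subseteq> H" "H \<subseteq> generate G (S \<union> (H \<inter> N))"
    by (rule noetherian_overE[OF assms(1) HD])
  have "generate G (S \<union> (H \<inter> N)) \<subseteq> generate G (S \<union> (H \<inter> N'))"
    using H assms(2) by (intro mono_generate) blast
  with S(3) have "H \<subseteq> generate G (S \<union> (H \<inter> N'))" by (rule subset_trans)
  with S(1,2) show "\<exists>S. finite S \<and> S \<subseteq> H \<and> H \<subseteq> generate G (S \<union> (H \<inter> N'))"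
    by (intro exI[of _ S] conjI)
qed

lemma noetherian_over_trivial:
  assumes "noetherian_over G D {\<one>}" "subgroup H G" "H \<subseteq> D"
  shows "\<exists>S. finite S \<and> S \<subseteq> H \<and> H = generate G S"
proof -
  obtain S where S: "finite S" "S \<subseteq> H" "H \<subseteq> generate G (S \<union> (H \<inter> {\<one>}))"
    using assms by (rule noetherian_overE)
  have "H \<subseteq> generate G (insert \<one> S)"
    using S(3) mono_generate[of "S \<union> (H \<inter> {\<one>})" "insert \<one> S"] by blast
  moreover have "generate G (insert \<one> S) \<subseteq> H"
    by (rule generate_subgroup_incl[OF _ assms(2)])
      (use S subgroup.one_closed[OF assms(2)] in blast)
  ultimately have "H = generate G (insert \<one> S)" by (rule subset_antisym)
  moreover have "finite (insert \<one> S)" "insert \<one> S \<subseteq> H"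
    using subgroup.one_closed[OF assms(2)] S(1,2) by simp_all
  ultimately show ?thesis by (intro exI[of _ "insert \<one> S"] conjI)
qed

section \<open>Homomorphisms to a Euclidean space\<close>

text \<open>Take elements of \<open>H\<close> whose values form a basis of the span of \<open>\<phi> ` H\<close>. Rounding down the
  coefficients of \<open>\<phi> h\<close> in this basis leaves a bounded remainder.\<close>

lemma additive_map_cobounded:
  fixes \<phi> :: "'a \<Rightarrow> 'e::euclidean_space"
  assumes H: "subgroup H G"
    and add: "\<And>g h. g \<in> H \<Longrightarrow> h \<in> H \<Longrightarrow> \<phi> (g \<otimes> h) = \<phi> g + \<phi> h"
  obtains S R where "finite S" "S \<subseteq> H"
    and "\<And>h. h \<in> H \<Longrightarrow> \<exists>w \<in> generate G S. norm (\<phi> (inv w \<otimes> h)) \<le> R"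
proof -
  interpret H: subgroup H G by (rule H)
  have one: "\<phi> \<one> = 0" using add[of \<one> \<one>] by simp
  have inv: "\<phi> (inv g) = - \<phi> g" if "g \<in> H" for g
    using add[of "inv g" g] that one by (simp add: eq_neg_iff_add_eq_0)
  have npow: "g [^] n \<in> H \<and> \<phi> (g [^] n) = real n *\<^sub>R \<phi> g" if "g \<in> H" for g and n :: nat
    by (induction n) (auto simp: that one add scaleR_left_distrib)
  have ipow: "\<phi> (g [^] k) = real_of_int k *\<^sub>R \<phi> g" if "g \<in> H" for g and k :: int
    by (simp add: int_pow_def2 inv npow[OF that] del: pow_nat)
  obtain B where B: "B \<subseteq> \<phi> ` H" "independent B" "\<phi> ` H \<subseteq> span B"
    by (rule maximal_independent_subset)
  have finB: "finite B" using B(2) by (rule independent_imp_finite)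
  have "\<forall>b\<in>B. \<exists>g. g \<in> H \<and> \<phi> g = b" using B(1) by blast
  then obtain s where "\<forall>b\<in>B. s b \<in> H \<and> \<phi> (s b) = b" by (rule bchoice[THEN exE])
  then have s: "\<And>b. b \<in> B \<Longrightarrow> s b \<in> H \<and> \<phi> (s b) = b" by blast
  have gen: "generate G (s ` B) \<subseteq> H"
    by (rule generate_subgroup_incl) (use s H in auto)
  have sub: "subgroup (generate G (s ` B)) G"
    using s H.subset by (intro generate_is_subgroup) blast
  have comb: "\<exists>w\<in>generate G (s ` B). \<phi> w = (\<Sum>b\<in>C. real_of_int (k b) *\<^sub>R b)"
    if "C \<subseteq> B" for C and k :: "'e \<Rightarrow> int"
    using finite_subset[OF that finB] that
  proof (induction C rule: finite_induct)
    case empty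
    show ?case using one generate.one[of G] by (intro bexI[of _ \<one>]) auto
  next
    case (insert b C)
    then obtain w where w: "w \<in> generate G (s ` B)" "\<phi> w = (\<Sum>b\<in>C. real_of_int (k b) *\<^sub>R b)"
      by auto
    have b: "b \<in> B" using insert by blast
    have sb: "s b [^] k b \<in> generate G (s ` B)"
      by (rule subgroup_int_pow_closed[OF sub]) (use b in \<open>auto intro: generate.incl\<close>)
    have "\<phi> (s b [^] k b \<otimes> w) = real_of_int (k b) *\<^sub>R b + \<phi> w"
      using add[OF subsetD[OF gen sb] subsetD[OF gen w(1)]] ipow[of "s b"] s[OF b] by simp
    with w sb insert show ?case
      by (intro bexI[of _ "s b [^] k b \<otimes> w"]) (auto intro: generate.eng)
  qed
  show ?thesis
  proof (rule that[of "s ` B" "\<Sum>b\<in>B. norm b"])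
    show "finite (s ` B)" "s ` B \<subseteq> H" using finB s by auto
    fix h assume h: "h \<in> H"
    then have "\<phi> h \<in> span B" using B by blast
    then obtain c where c: "\<phi> h = (\<Sum>b\<in>B. c b *\<^sub>R b)"
      using finB by (auto simp: span_finite)
    obtain w where w: "w \<in> generate G (s ` B)" "\<phi> w = (\<Sum>b\<in>B. real_of_int \<lfloor>c b\<rfloor> *\<^sub>R b)"
      using comb[of B "\<lambda>b. \<lfloor>c b\<rfloor>"] by auto
    have "\<phi> (inv w \<otimes> h) = \<phi> h - \<phi> w"
      using add inv w gen h by auto
    also have "\<dots> = (\<Sum>b\<in>B. frac (c b) *\<^sub>R b)"
      by (simp add: c w frac_def algebra_simps sum_subtractf)
    also have "norm \<dots> \<le> (\<Sum>b\<in>B. norm b)"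
    proof (rule order.trans[OF norm_sum sum_mono])
      fix b show "norm (frac (c b) *\<^sub>R b) \<le> norm b"
        using frac_lt_1[of "c b"] by (simp add: mult_left_le_one_le)
    qed
    finally show "\<exists>w \<in> generate G (s ` B). norm (\<phi> (inv w \<otimes> h)) \<le> (\<Sum>b\<in>B. norm b)"
      using w by blast
  qed
qed

text \<open>This generalizes the finite generation of discrete subgroups of a Euclidean space.
  Elements with the same value of \<open>f\<close> lie in the same coset of \<open>N\<close>, so the finiteness hypothesis
  expresses that \<open>\<phi>\<close> is proper on \<open>D / N\<close>.\<close>

lemma noetherian_over_proper_map:
  fixes \<phi> :: "'a \<Rightarrow> 'e::euclidean_space"
  assumes add: "\<And>g h. g \<in> D \<Longrightarrow> h \<in> D \<Longrightarrow> \<phi> (g \<otimes> h) = \<phi> g + \<phi> h"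
    and N: "\<And>g h. g \<in> D \<Longrightarrow> h \<in> D \<Longrightarrow> f g = f h \<Longrightarrow> inv g \<otimes> h \<in> N"
    and fin: "\<And>R. finite (f ` {g \<in> D. norm (\<phi> g) \<le> R})"
  shows "noetherian_over G D N"
  unfolding noetherian_over_def
proof (intro allI impI)
  fix H assume "subgroup H G \<and> H \<subseteq> D"
  then have H: "subgroup H G" and HD: "H \<subseteq> D" by auto
  interpret H: subgroup H G by (rule H)
  have addH: "\<phi> (g \<otimes> h) = \<phi> g + \<phi> h" if "g \<in> H" "h \<in> H" for g h
    using add that HD by blast
  obtain S R where S: "finite S" "S \<subseteq> H"
    and R: "\<And>h. h \<in> H \<Longrightarrow> \<exists>w \<in> generate G S. norm (\<phi> (inv w \<otimes> h)) \<le> R"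
    using additive_map_cobounded[OF H, of \<phi>] addH by blast
  define K where "K = {g \<in> H. norm (\<phi> g) \<le> R}"
  define T where "T = (\<lambda>y. SOME t. t \<in> K \<and> f t = y) ` f ` K"
  have "finite (f ` K)"
    by (rule finite_subset[OF _ fin[of R]]) (use HD in \<open>auto simp: K_def\<close>)
  then have "finite T" by (simp add: T_def)
  have rep: "\<exists>t\<in>T. t \<in> K \<and> f t = f k" if "k \<in> K" for k
  proof -
    have "(SOME t. t \<in> K \<and> f t = f k) \<in> K \<and> f (SOME t. t \<in> K \<and> f t = f k) = f k"
      using that by (intro someI[of "\<lambda>t. t \<in> K \<and> f t = f k" k]) auto
    then show ?thesis unfolding T_def using that by blast
  qed
  have TK: "T \<subseteq> K"
  proof
    fix t assume "t \<in> T"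
    then obtain k where "k \<in> K" "t = (SOME t. t \<in> K \<and> f t = f k)" by (auto simp: T_def)
    then show "t \<in> K" using someI[of "\<lambda>t. t \<in> K \<and> f t = f k" k] by auto
  qed
  let ?U = "S \<union> T \<union> (H \<inter> N)"
  have "h \<in> generate G ?U" if h: "h \<in> H" for h
  proof -
    obtain w where w: "w \<in> generate G S" "norm (\<phi> (inv w \<otimes> h)) \<le> R" using R[OF h] by blast
    have wH: "w \<in> H" using w(1) generate_subgroup_incl[OF S(2) H] by blast
    let ?k = "inv w \<otimes> h"
    have "?k \<in> K" using w wH h by (simp add: K_def)
    then obtain t where t: "t \<in> T" "t \<in> K" "f t = f ?k" using rep by blast
    have tH: "t \<in> H" using t by (simp add: K_def)
    have "inv t \<otimes> ?k \<in> H \<inter> N"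
      using N[of t ?k] t tH wH h HD by auto
    then have 1: "inv t \<otimes> ?k \<in> generate G ?U" by (simp add: generate.incl)
    have 2: "t \<in> generate G ?U" using t by (simp add: generate.incl)
    have 3: "w \<in> generate G ?U" using w(1) mono_generate[of S ?U] by blast
    have "h = w \<otimes> (t \<otimes> (inv t \<otimes> ?k))"
      using wH tH h by (simp add: m_assoc[symmetric])
    then show ?thesis using 1 2 3 by (metis generate.eng)
  qed
  then have "H \<subseteq> generate G ?U" by blast
  moreover have "finite (S \<union> T)" "S \<union> T \<subseteq> H" using S \<open>finite T\<close> TK by (auto simp: K_def)
  ultimately show "\<exists>S. finite S \<and> S \<subseteq> H \<and> H \<subseteq> generate G (S \<union> (H \<inter> N))"
    by (intro exI[of _ "S \<union> T"] conjI)
qed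

lemma noetherian_over_finite_values:
  assumes fin: "finite (f ` D)"
    and N: "\<And>g h. g \<in> D \<Longrightarrow> h \<in> D \<Longrightarrow> f g = f h \<Longrightarrow> inv g \<otimes> h \<in> N"
  shows "noetherian_over G D N"
proof (rule noetherian_over_proper_map[of D "\<lambda>_. 0 :: real" f])
  show "finite (f ` {g \<in> D. norm (0 :: real) \<le> R})" for R
    by (rule finite_subset[OF _ fin]) auto
qed (simp_all add: N)

end

section \<open>Discrete groups of triangular two-by-two matrices\<close>

definition locally_finite :: "'e::real_normed_vector set \<Rightarrow> bool" where
  "locally_finite L \<longleftrightarrow> (\<forall>R. finite {v \<in> L. norm v \<le> R})"

text \<open>Up to inversion a multiplier has modulus at most one, and then it keeps \<open>v\<close> in a bounded
  part of \<open>L\<close>.\<close>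

lemma finite_multipliers:
  fixes X L :: "complex set"
  assumes L: "locally_finite L" and v: "v \<noteq> 0"
    and XL: "\<And>c. c \<in> X \<Longrightarrow> c * v \<in> L"
    and inv: "\<And>c. c \<in> X \<Longrightarrow> c \<noteq> 0 \<and> inverse c \<in> X"
  shows "finite X"
proof -
  let ?Y = "{c \<in> X. cmod c \<le> 1}"
  have "(\<lambda>c. c * v) ` ?Y \<subseteq> {u \<in> L. norm u \<le> norm v}"
    using XL by (auto simp: norm_mult mult_left_le_one_le)
  moreover have "finite {u \<in> L. norm u \<le> norm v}"
    using L unfolding locally_finite_def by blast
  ultimately have "finite ((\<lambda>c. c * v) ` ?Y)" by (rule finite_subset)
  then have Y: "finite ?Y"
    by (rule finite_imageD) (use v in \<open>auto simp: inj_on_def\<close>)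
  have "X \<subseteq> ?Y \<union> inverse ` ?Y"
  proof
    fix c assume c: "c \<in> X"
    show "c \<in> ?Y \<union> inverse ` ?Y"
    proof (cases "cmod c \<le> 1")
      case False
      then have "cmod (inverse c) \<le> 1" by (simp add: norm_inverse inverse_le_1_iff)
      then have "inverse c \<in> ?Y" using inv[OF c] by simp
      then have "inverse (inverse c) \<in> inverse ` ?Y" by (rule imageI)
      then show ?thesis by simp
    qed (use c in simp)
  qed
  then show ?thesis by (rule finite_subset) (simp add: Y)
qed

lemma finite_multipliers_pair:
  fixes X :: "complex set" and L :: "(complex \<times> complex) set"
  assumes L: "locally_finite L" and v: "(v, w) \<noteq> (0, 0)"
    and XL: "\<And>c. c \<in> X \<Longrightarrow> (c * v, c * w) \<in> L"
    and inv: "\<And>c. c \<in> X \<Longrightarrow> c \<noteq> 0 \<and> inverse c \<in> X"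
  shows "finite X"
proof (rule finite_multipliers[of "{c. (c * v, c * w) \<in> L}" 1])
  show "locally_finite {c. (c * v, c * w) \<in> L}"
    unfolding locally_finite_def
  proof
    fix R
    let ?f = "\<lambda>c. (c * v, c * w)"
    have "?f ` {c \<in> {c. ?f c \<in> L}. norm c \<le> R} \<subseteq> {x \<in> L. norm x \<le> R * (cmod v + cmod w)}"
    proof (rule image_subsetI)
      fix c assume "c \<in> {c \<in> {c. ?f c \<in> L}. norm c \<le> R}"
      then have c: "?f c \<in> L" "cmod c \<le> R" by auto
      have "norm (?f c) \<le> cmod c * cmod v + cmod c * cmod w"
        by (metis norm_Pair_le norm_mult)
      also have "\<dots> \<le> R * (cmod v + cmod w)"
        using c(2) by (simp add: distrib_left[symmetric] mult_right_mono)
      finally show "?f c \<in> {x \<in> L. norm x \<le> R * (cmod v + cmod w)}" using c by simp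
    qed
    moreover have "finite {x \<in> L. norm x \<le> R * (cmod v + cmod w)}"
      using L unfolding locally_finite_def by blast
    ultimately have "finite (?f ` {c \<in> {c. ?f c \<in> L}. norm c \<le> R})" by (rule finite_subset)
    then show "finite {c \<in> {c. ?f c \<in> L}. norm c \<le> R}"
      by (rule finite_imageD) (use v in \<open>auto simp: inj_on_def\<close>)
  qed
qed (use XL inv in auto)

text \<open>A set of linear maps that move a basis within a discrete set is itself discrete, since a
  linear map is determined by what it does to a basis.\<close>

lemma finite_bounded_triangular_maps:
  fixes T :: "(complex \<times> complex \<times> complex) set"
  assumes L: "locally_finite L" and ind: "u * v' \<noteq> u' * v"
    and T: "\<And>p q r. (p, q, r) \<in> T \<Longrightarrow> (p * u + q * v, r * v) \<in> L \<and> (p * u' + q * v', r * v') \<in> L"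
  shows "finite {(p, q, r) \<in> T. cmod p \<le> R \<and> cmod q \<le> R \<and> cmod r \<le> R}" (is "finite ?K")
proof -
  define B where "B = R * (cmod u + cmod v + cmod v) + R * (cmod u' + cmod v' + cmod v')"
  let ?F = "\<lambda>(p, q, r). ((p * u + q * v, r * v), (p * u' + q * v', r * v'))"
  have bound: "norm (p * w + q * z, r * z) \<le> R * (cmod w + cmod z + cmod z)"
    if "cmod p \<le> R" "cmod q \<le> R" "cmod r \<le> R" for p q r w z
  proof -
    have "norm (p * w + q * z, r * z) \<le> cmod (p * w + q * z) + cmod (r * z)"
      by (rule norm_Pair_le)
    also have "\<dots> \<le> cmod p * cmod w + cmod q * cmod z + cmod r * cmod z"
      using norm_triangle_ineq[of "p * w" "q * z"] by (simp add: norm_mult)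
    also have "\<dots> \<le> R * cmod w + R * cmod z + R * cmod z"
      by (intro add_mono mult_right_mono that) auto
    finally show ?thesis by (simp add: algebra_simps)
  qed
  have "?F ` ?K \<subseteq> {x \<in> L. norm x \<le> B} \<times> {x \<in> L. norm x \<le> B}"
  proof (rule image_subsetI)
    fix s assume "s \<in> ?K"
    then obtain p q r where s: "s = (p, q, r)"
      and K: "(p, q, r) \<in> T" "cmod p \<le> R" "cmod q \<le> R" "cmod r \<le> R" by auto
    then have "0 \<le> R" using norm_ge_zero order_trans by blast
    then have "0 \<le> R * (cmod u + cmod v + cmod v)" "0 \<le> R * (cmod u' + cmod v' + cmod v')"
      by (auto intro!: mult_nonneg_nonneg add_nonneg_nonneg)
    then show "?F s \<in> {x \<in> L. norm x \<le> B} \<times> {x \<in> L. norm x \<le> B}"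
      using T[OF K(1)] bound[OF K(2-4), of u v] bound[OF K(2-4), of u' v'] unfolding B_def s
      by auto
  qed
  then have "finite (?F ` ?K)"
    using L unfolding locally_finite_def by (meson finite_SigmaI finite_subset)
  moreover have "inj_on ?F ?K"
  proof (rule inj_onI)
    fix s t assume "?F s = ?F t"
    moreover obtain p q r where s: "s = (p, q, r)" by (cases s)
    moreover obtain p' q' r' where t: "t = (p', q', r')" by (cases t)
    ultimately have 1: "(p - p') * u + (q - q') * v = 0" "(p - p') * u' + (q - q') * v' = 0"
      and 2: "(r - r') * v = 0" "(r - r') * v' = 0"
      by (auto simp: algebra_simps)
    have "(p - p') * (u * v' - u' * v)
        = ((p - p') * u + (q - q') * v) * v' - ((p - p') * u' + (q - q') * v') * v"
      by (simp add: algebra_simps)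
    then have p: "p = p'" using 1 ind by simp
    moreover have "v \<noteq> 0 \<or> v' \<noteq> 0" using ind by auto
    ultimately show "s = t" using 1 2 by (auto simp: s t)
  qed
  ultimately show ?thesis by (rule finite_imageD)
qed

text \<open>The homomorphism \<open>g \<mapsto> ((p, q), (0, r))\<close> has discrete image: only finitely many of its
  values lie in any given compact part of the matrix group.\<close>

locale triangular2 = group +
  fixes D and p q r :: "'a \<Rightarrow> complex"
  assumes D: "subgroup D G"
    and nonzero: "\<And>g. g \<in> D \<Longrightarrow> p g \<noteq> 0 \<and> r g \<noteq> 0"
    and p_mult: "\<And>g h. g \<in> D \<Longrightarrow> h \<in> D \<Longrightarrow> p (g \<otimes> h) = p g * p h"
    and r_mult: "\<And>g h. g \<in> D \<Longrightarrow> h \<in> D \<Longrightarrow> r (g \<otimes> h) = r g * r h"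
    and q_mult: "\<And>g h. g \<in> D \<Longrightarrow> h \<in> D \<Longrightarrow> q (g \<otimes> h) = p g * q h + q g * r h"
    and proper: "\<And>R. finite ((\<lambda>g. (p g, q g, r g)) `
      {g \<in> D. cmod (p g) \<le> R \<and> cmod (1 / p g) \<le> R \<and> cmod (q g) \<le> R \<and>
              cmod (r g) \<le> R \<and> cmod (1 / r g) \<le> R})"
begin

lemma D_closed: "g \<in> D \<Longrightarrow> h \<in> D \<Longrightarrow> g \<otimes> h \<in> D" "g \<in> D \<Longrightarrow> inv g \<in> D" "\<one> \<in> D"
    "g \<in> D \<Longrightarrow> g \<in> carrier G"
  using subgroup.m_closed[OF D] subgroup.m_inv_closed[OF D] subgroup.one_closed[OF D]
    subgroup.mem_carrier[OF D] by simp_all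

lemma p_one: "p \<one> = 1" and r_one: "r \<one> = 1"
  using p_mult[of \<one> \<one>] r_mult[of \<one> \<one>] nonzero[of \<one>] D_closed by auto

lemma p_inv: "g \<in> D \<Longrightarrow> p (inv g) = 1 / p g" and r_inv: "g \<in> D \<Longrightarrow> r (inv g) = 1 / r g"
  using p_mult[of "inv g" g] r_mult[of "inv g" g] nonzero[of g] p_one r_one D_closed
  by (auto simp: field_simps)

definition unip :: "'a set" where "unip = {g \<in> D. p g = 1 \<and> r g = 1}"

lemma diag_separates_unip:
  assumes "g \<in> D" "h \<in> D" "(p g, r g) = (p h, r h)"
  shows "inv g \<otimes> h \<in> unip"
  using assms nonzero[of h] by (simp add: unip_def D_closed p_mult r_mult p_inv r_inv)

lemma q_conj:
  assumes "g \<in> D" "u \<in> unip"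
  shows "g \<otimes> u \<otimes> inv g \<in> unip" and "q (g \<otimes> u \<otimes> inv g) = p g / r g * q u"
proof -
  have u: "u \<in> D" "p u = 1" "r u = 1" using assms(2) by (auto simp: unip_def)
  show w: "g \<otimes> u \<otimes> inv g \<in> unip"
    using u assms(1) nonzero[of g] by (simp add: unip_def D_closed p_mult r_mult p_inv r_inv)
  then have w': "g \<otimes> u \<otimes> inv g \<in> D" "p (g \<otimes> u \<otimes> inv g) = 1"
    by (auto simp: unip_def)
  have "g \<otimes> u \<otimes> inv g \<otimes> g = g \<otimes> u" using assms(1) u D_closed(4) by (simp add: m_assoc)
  then have "q (g \<otimes> u \<otimes> inv g \<otimes> g) = q (g \<otimes> u)" by simp
  then have "q g + q (g \<otimes> u \<otimes> inv g) * r g = p g * q u + q g"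
    using q_mult[OF w'(1) assms(1)] q_mult[OF assms(1) u(1)] w' u by simp
  then show "q (g \<otimes> u \<otimes> inv g) = p g / r g * q u"
    using nonzero[OF assms(1)] by (simp add: field_simps)
qed

lemma finite_bounded_diag:
  assumes "E \<subseteq> D"
    and "\<And>g. g \<in> E \<Longrightarrow> cmod (p g) \<le> M \<and> cmod (1 / p g) \<le> M \<and> cmod (q g) \<le> M \<and>
        cmod (r g) \<le> M \<and> cmod (1 / r g) \<le> M"
  shows "finite ((\<lambda>g. (p g, r g)) ` E)"
proof -
  have "(\<lambda>g. (p g, r g)) ` E = (\<lambda>(x, y, z). (x, z)) ` (\<lambda>g. (p g, q g, r g)) ` E"
    by (simp add: image_image)
  moreover have "finite ((\<lambda>g. (p g, q g, r g)) ` E)"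
    by (rule finite_subset[OF _ proper[of M]]) (use assms in blast)
  ultimately show ?thesis by simp
qed

lemma ln_bounds:
  assumes "\<bar>ln (cmod c)\<bar> \<le> R" "c \<noteq> 0"
  shows "cmod c \<le> exp R" "cmod (1 / c) \<le> exp R"
proof -
  have "ln (cmod c) \<le> R" "- ln (cmod c) \<le> R" using assms(1) by auto
  then have "exp (ln (cmod c)) \<le> exp R" "exp (- ln (cmod c)) \<le> exp R" by simp_all
  then show "cmod c \<le> exp R" "cmod (1 / c) \<le> exp R"
    using assms(2) by (auto simp: exp_minus norm_divide norm_inverse divide_inverse)
qed

text \<open>Matrices with equal diagonal entries form a commutative group, on which \<open>ln |p|\<close> and
  \<open>q / p\<close> together form a proper homomorphism.\<close>

lemma noetherian_over_unip_equal_diag: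
  assumes E: "subgroup E G" "E \<subseteq> D" and eq: "\<And>g. g \<in> E \<Longrightarrow> p g = r g"
  shows "noetherian_over G E unip"
proof (rule noetherian_over_proper_map[of E "\<lambda>g. (ln (cmod (p g)), q g / p g)" "\<lambda>g. (p g, r g)"])
  fix g h assume gh: "g \<in> E" "h \<in> E"
  then have "g \<in> D" "h \<in> D" using E by auto
  then show "(ln (cmod (p (g \<otimes> h))), q (g \<otimes> h) / p (g \<otimes> h)) =
      (ln (cmod (p g)), q g / p g) + (ln (cmod (p h)), q h / p h)"
    using nonzero[of g] nonzero[of h] eq[OF gh(2)]
    by (simp add: p_mult q_mult norm_mult ln_mult field_simps)
next
  fix g h assume "g \<in> E" "h \<in> E" "(p g, r g) = (p h, r h)"
  then show "inv g \<otimes> h \<in> unip" using E by (intro diag_separates_unip) auto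
next
  fix R
  show "finite ((\<lambda>g. (p g, r g)) ` {g \<in> E. norm (ln (cmod (p g)), q g / p g) \<le> R})"
  proof (rule finite_bounded_diag[where M = "(1 + R) * exp R"])
    fix g assume g: "g \<in> {g \<in> E. norm (ln (cmod (p g)), q g / p g) \<le> R}"
    then have ln: "\<bar>ln (cmod (p g))\<bar> \<le> R" and q: "cmod (q g / p g) \<le> R"
      using norm_fst_le[of "ln (cmod (p g))" "q g / p g"] norm_snd_le[of "q g / p g" "ln (cmod (p g))"]
      by auto
    have p: "p g \<noteq> 0" using g E nonzero by auto
    have R: "0 \<le> R" using ln by linarith
    then have M: "exp R \<le> (1 + R) * exp R" "R * exp R \<le> (1 + R) * exp R"
      by (simp_all add: algebra_simps)
    have "cmod (q g) = cmod (q g / p g) * cmod (p g)" using p by (simp add: norm_divide)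
    also have "\<dots> \<le> R * exp R" using q ln_bounds(1)[OF ln p] R by (intro mult_mono) auto
    finally have "cmod (q g) \<le> (1 + R) * exp R" using M by linarith
    then show "cmod (p g) \<le> (1 + R) * exp R \<and> cmod (1 / p g) \<le> (1 + R) * exp R \<and>
        cmod (q g) \<le> (1 + R) * exp R \<and> cmod (r g) \<le> (1 + R) * exp R \<and>
        cmod (1 / r g) \<le> (1 + R) * exp R"
      using order.trans[OF ln_bounds(1)[OF ln p] M(1)] order.trans[OF ln_bounds(2)[OF ln p] M(1)]
        eq[of g] g by simp
  qed (use E in auto)
qed

text \<open>If \<open>g0\<close> has distinct eigenvalues and everything commutes with it, then \<open>q\<close> is a function
  of the diagonal, and the logarithms of the moduli of \<open>p\<close> and \<open>r\<close> form a proper homomorphism.\<close>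

lemma noetherian_over_unip_distinct_diag:
  assumes g0: "g0 \<in> D" "p g0 \<noteq> r g0"
    and comm: "\<And>g. g \<in> D \<Longrightarrow> q (g \<otimes> g0) = q (g0 \<otimes> g)"
  shows "noetherian_over G D unip"
proof -
  define c where "c = q g0 / (p g0 - r g0)"
  have q: "q g = c * (p g - r g)" if "g \<in> D" for g
  proof -
    have "p g * q g0 + q g * r g0 = p g0 * q g + q g0 * r g"
      using comm[OF that] q_mult that g0 by simp
    then have "q g * (p g0 - r g0) = q g0 * (p g - r g)" by (simp add: algebra_simps)
    then show ?thesis using g0 by (simp add: c_def field_simps)
  qed
  show ?thesis
  proof (rule noetherian_over_proper_map[of D "\<lambda>g. (ln (cmod (p g)), ln (cmod (r g)))"
        "\<lambda>g. (p g, r g)"])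
    fix g h assume "g \<in> D" "h \<in> D"
    then show "(ln (cmod (p (g \<otimes> h))), ln (cmod (r (g \<otimes> h)))) =
        (ln (cmod (p g)), ln (cmod (r g))) + (ln (cmod (p h)), ln (cmod (r h)))"
      using nonzero[of g] nonzero[of h] by (simp add: p_mult r_mult norm_mult ln_mult)
  next
    fix R
    show "finite ((\<lambda>g. (p g, r g)) ` {g \<in> D. norm (ln (cmod (p g)), ln (cmod (r g))) \<le> R})"
    proof (rule finite_bounded_diag[where M = "exp R + cmod c * (exp R + exp R)"])
      fix g assume g: "g \<in> {g \<in> D. norm (ln (cmod (p g)), ln (cmod (r g))) \<le> R}"
      then have ln: "\<bar>ln (cmod (p g))\<bar> \<le> R" "\<bar>ln (cmod (r g))\<bar> \<le> R"
        using norm_fst_le[of "ln (cmod (p g))" "ln (cmod (r g))"]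
          norm_snd_le[of "ln (cmod (r g))" "ln (cmod (p g))"] by auto
      have nz: "p g \<noteq> 0" "r g \<noteq> 0" using g nonzero by auto
      note b = ln_bounds[OF ln(1) nz(1)] ln_bounds[OF ln(2) nz(2)]
      have "cmod (p g - r g) \<le> exp R + exp R"
        using norm_triangle_ineq4[of "p g" "r g"] b by linarith
      then have "cmod (q g) \<le> cmod c * (exp R + exp R)"
        using g by (simp add: q norm_mult mult_left_mono)
      moreover have "0 \<le> cmod c * (exp R + exp R)" by simp
      moreover have "0 \<le> exp R" by simp
      ultimately show "cmod (p g) \<le> exp R + cmod c * (exp R + exp R) \<and>
          cmod (1 / p g) \<le> exp R + cmod c * (exp R + exp R) \<and>
          cmod (q g) \<le> exp R + cmod c * (exp R + exp R) \<and>
          cmod (r g) \<le> exp R + cmod c * (exp R + exp R) \<and>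
          cmod (1 / r g) \<le> exp R + cmod c * (exp R + exp R)"
        using b by linarith
    qed auto
  qed (rule diag_separates_unip)
qed

text \<open>If there is a unipotent element with \<open>q \<noteq> 0\<close>, conjugation multiplies this entry by \<open>p / r\<close>
  and keeps it in a discrete set, so that \<open>p / r\<close> takes finitely many values and \<open>p = r\<close> on a
  subgroup of finite index. If there is none, the matrices commute, because commutators are
  unipotent.\<close>

theorem noetherian_over_unip: "noetherian_over G D unip"
proof (cases "\<exists>u\<in>unip. q u \<noteq> 0")
  case True
  then obtain u where u: "u \<in> unip" "q u \<noteq> 0" by blast
  have lf: "locally_finite (q ` unip)"
    unfolding locally_finite_def
  proof
    fix R
    have "{v \<in> q ` unip. norm v \<le> R} \<subseteq> (\<lambda>(x, y, z). y) ` (\<lambda>g. (p g, q g, r g)) `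
        {g \<in> D. cmod (p g) \<le> max 1 R \<and> cmod (1 / p g) \<le> max 1 R \<and> cmod (q g) \<le> max 1 R \<and>
              cmod (r g) \<le> max 1 R \<and> cmod (1 / r g) \<le> max 1 R}"
      by (auto simp: unip_def image_image intro!: imageI)
    then show "finite {v \<in> q ` unip. norm v \<le> R}"
      using proper[of "max 1 R"] finite_subset by blast
  qed
  have fin: "finite ((\<lambda>g. p g / r g) ` D)"
  proof (rule finite_multipliers[OF lf u(2)])
    fix c assume "c \<in> (\<lambda>g. p g / r g) ` D"
    then obtain g where g: "g \<in> D" "c = p g / r g" by auto
    show "c * q u \<in> q ` unip" using q_conj[OF g(1) u(1)] g(2) by (metis imageI)
    have "inverse c = p (inv g) / r (inv g)" using g by (simp add: p_inv r_inv)
    then show "c \<noteq> 0 \<and> inverse c \<in> (\<lambda>g. p g / r g) ` D"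
      using g nonzero[of g] D_closed(2)[of g] by auto
  qed
  let ?E = "{g \<in> D. p g = r g}"
  have E: "subgroup ?E G"
  proof (rule subgroupI)
    show "?E \<noteq> {}" using D_closed(3) p_one r_one by auto
  qed (auto simp: D_closed p_mult r_mult p_inv r_inv)
  have "noetherian_over G D ?E"
  proof (rule noetherian_over_finite_values[OF fin])
    fix g h assume gh: "g \<in> D" "h \<in> D" "p g / r g = p h / r h"
    then have "p h / p g = r h / r g" using nonzero[of g] nonzero[of h] by (simp add: field_simps)
    then show "inv g \<otimes> h \<in> ?E" using gh by (simp add: D_closed p_mult r_mult p_inv r_inv)
  qed
  moreover have "noetherian_over G ?E unip"
    by (rule noetherian_over_unip_equal_diag[OF E]) auto
  ultimately show ?thesis using E by (rule noetherian_over_trans)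
next
  case False
  have comm: "q (g \<otimes> h) = q (h \<otimes> g)" if gh: "g \<in> D" "h \<in> D" for g h
  proof -
    let ?k = "g \<otimes> h \<otimes> inv (h \<otimes> g)"
    have k: "?k \<in> unip"
      using gh nonzero[of g] nonzero[of h]
      by (simp add: unip_def D_closed p_mult r_mult p_inv r_inv)
    then have "q ?k = 0" using False by blast
    moreover have "?k \<otimes> (h \<otimes> g) = g \<otimes> h" using gh D_closed(4) by (simp add: m_assoc)
    ultimately show ?thesis
      using q_mult[of ?k "h \<otimes> g"] k gh by (simp add: unip_def D_closed)
  qed
  show ?thesis
  proof (cases "\<forall>g\<in>D. p g = r g")
    case True
    then show ?thesis using noetherian_over_unip_equal_diag[OF D] by blast
  next
    case False
    then show ?thesis using noetherian_over_unip_distinct_diag comm by blast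
  qed
qed

end

section \<open>Discrete groups of triangular three-by-three matrices\<close>

text \<open>The functions are the entries of the matrix \<open>((a, x, z), (0, b, y), (0, 0, 1))\<close> that
  represents the projective class of an upper triangular matrix.\<close>

locale triangular3_rep = group +
  fixes a b x y z :: "'a \<Rightarrow> complex"
  assumes nonzero: "\<And>g. g \<in> carrier G \<Longrightarrow> a g \<noteq> 0 \<and> b g \<noteq> 0"
    and a_mult: "\<And>g h. g \<in> carrier G \<Longrightarrow> h \<in> carrier G \<Longrightarrow> a (g \<otimes> h) = a g * a h"
    and b_mult: "\<And>g h. g \<in> carrier G \<Longrightarrow> h \<in> carrier G \<Longrightarrow> b (g \<otimes> h) = b g * b h"
    and x_mult: "\<And>g h. g \<in> carrier G \<Longrightarrow> h \<in> carrier G \<Longrightarrow> x (g \<otimes> h) = a g * x h + x g * b h"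
    and y_mult: "\<And>g h. g \<in> carrier G \<Longrightarrow> h \<in> carrier G \<Longrightarrow> y (g \<otimes> h) = b g * y h + y g"
    and z_mult: "\<And>g h. g \<in> carrier G \<Longrightarrow> h \<in> carrier G \<Longrightarrow>
      z (g \<otimes> h) = a g * z h + x g * y h + z g"
begin

lemmas mults = a_mult b_mult x_mult y_mult z_mult

lemma ones: "a \<one> = 1" "b \<one> = 1" "x \<one> = 0" "y \<one> = 0" "z \<one> = 0"
proof -
  show a: "a \<one> = 1" and b: "b \<one> = 1"
    using a_mult[of \<one> \<one>] b_mult[of \<one> \<one>] nonzero[of \<one>] by auto
  show x: "x \<one> = 0" using x_mult[of \<one> \<one>] a b by simp
  show y: "y \<one> = 0" using y_mult[of \<one> \<one>] b by simp
  show "z \<one> = 0" using z_mult[of \<one> \<one>] a x by simp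
qed

lemma invs:
  assumes g: "g \<in> carrier G"
  shows "a (inv g) = 1 / a g" "b (inv g) = 1 / b g" "x (inv g) = - x g / (a g * b g)"
    "y (inv g) = - y g / b g" "z (inv g) = (x g * y g / b g - z g) / a g"
proof -
  have i: "g \<otimes> inv g = \<one>" "inv g \<in> carrier G" using g by auto
  show a: "a (inv g) = 1 / a g" and b: "b (inv g) = 1 / b g"
    using a_mult[OF g i(2)] b_mult[OF g i(2)] nonzero[OF g] by (auto simp: i ones field_simps)
  show "x (inv g) = - x g / (a g * b g)"
    using x_mult[OF g i(2)] nonzero[OF g] b by (simp add: i(1) ones field_simps eq_neg_iff_add_eq_0)
  show y: "y (inv g) = - y g / b g"
    using y_mult[OF g i(2)] nonzero[OF g] by (simp add: i(1) ones field_simps eq_neg_iff_add_eq_0)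
  have "a g * z (inv g) = x g * y g / b g - z g"
    using z_mult[OF g i(2)] y by (simp add: i(1) ones algebra_simps eq_neg_iff_add_eq_0)
  then show "z (inv g) = (x g * y g / b g - z g) / a g"
    using nonzero[OF g] by (metis nonzero_mult_div_cancel_left)
qed

end

text \<open>Discreteness in a form without topology: every compact part of the matrix group contains
  only finitely many elements of the group.\<close>

locale triangular3 = triangular3_rep +
  assumes finite_bounded: "\<And>R. finite {g \<in> carrier G. cmod (a g) \<le> R \<and> cmod (1 / a g) \<le> R \<and>
      cmod (b g) \<le> R \<and> cmod (1 / b g) \<le> R \<and> cmod (x g) \<le> R \<and> cmod (y g) \<le> R \<and> cmod (z g) \<le> R}"
begin

lemma finite_of_bounds:
  assumes "E \<subseteq> carrier G"
    and "\<And>g. g \<in> E \<Longrightarrow> cmod (a g) \<le> R \<and> cmod (1 / a g) \<le> R \<and> cmod (b g) \<le> R \<and>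
      cmod (1 / b g) \<le> R \<and> cmod (x g) \<le> R \<and> cmod (y g) \<le> R \<and> cmod (z g) \<le> R"
  shows "finite E"
  by (rule finite_subset[OF _ finite_bounded[of R]]) (use assms in blast)

definition unip :: "'a set" where "unip = {g \<in> carrier G. a g = 1 \<and> b g = 1}"

lemma unipD: "u \<in> unip \<Longrightarrow> u \<in> carrier G" "u \<in> unip \<Longrightarrow> a u = 1" "u \<in> unip \<Longrightarrow> b u = 1"
  by (auto simp: unip_def)

lemma subgroup_unip: "subgroup unip G"
proof (rule subgroupI)
  show "unip \<noteq> {}" using ones by (auto simp: unip_def)
qed (auto simp: unip_def mults invs)

lemma conj:
  assumes g: "g \<in> carrier G" and u: "u \<in> unip"
  shows "g \<otimes> u \<otimes> inv g \<in> unip"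
    and "x (g \<otimes> u \<otimes> inv g) = a g / b g * x u"
    and "y (g \<otimes> u \<otimes> inv g) = b g * y u"
    and "z (g \<otimes> u \<otimes> inv g) = a g * z u + x g * y u - a g / b g * x u * y g"
proof -
  note u' = unipD[OF u]
  let ?w = "g \<otimes> u \<otimes> inv g"
  show w: "?w \<in> unip"
    using nonzero[OF g] g u' by (simp add: unip_def mults invs)
  note w' = unipD[OF w]
  have e: "?w \<otimes> g = g \<otimes> u" using g u' by (simp add: m_assoc)
  have "x ?w * b g + x g = a g * x u + x g"
    using arg_cong[OF e, of x] x_mult[OF w'(1) g] x_mult[OF g u'(1)] u' w' by simp
  then show x: "x ?w = a g / b g * x u" using nonzero[OF g] by (simp add: field_simps)
  show "y ?w = b g * y u"
    using arg_cong[OF e, of y] y_mult[OF w'(1) g] y_mult[OF g u'(1)] u' w' by simp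
  have "z g + x ?w * y g + z ?w = a g * z u + x g * y u + z g"
    using arg_cong[OF e, of z] z_mult[OF w'(1) g] z_mult[OF g u'(1)] u' w'
    by (simp add: algebra_simps)
  then have "z ?w = a g * z u + x g * y u - x ?w * y g" by (simp add: algebra_simps)
  then show "z ?w = a g * z u + x g * y u - a g / b g * x u * y g" by (simp only: x)
qed

lemma commutator_unip:
  assumes "g \<in> carrier G" "h \<in> carrier G"
  shows "g \<otimes> h \<otimes> inv (h \<otimes> g) \<in> unip"
    and "x (g \<otimes> h) = x (h \<otimes> g) + x (g \<otimes> h \<otimes> inv (h \<otimes> g)) * b (h \<otimes> g)"
    and "y (g \<otimes> h) = y (h \<otimes> g) + y (g \<otimes> h \<otimes> inv (h \<otimes> g))"
    and "z (g \<otimes> h) = z (h \<otimes> g) + x (g \<otimes> h \<otimes> inv (h \<otimes> g)) * y (h \<otimes> g)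
      + z (g \<otimes> h \<otimes> inv (h \<otimes> g))"
proof -
  let ?k = "g \<otimes> h \<otimes> inv (h \<otimes> g)"
  show k: "?k \<in> unip"
    using nonzero[OF assms(1)] nonzero[OF assms(2)] assms
    by (simp add: unip_def a_mult b_mult invs)
  note k' = unipD[OF k]
  have hg: "h \<otimes> g \<in> carrier G" using assms by simp
  have e: "?k \<otimes> (h \<otimes> g) = g \<otimes> h" using assms by (simp add: m_assoc)
  show "x (g \<otimes> h) = x (h \<otimes> g) + x ?k * b (h \<otimes> g)"
    using x_mult[OF k'(1) hg] k' unfolding e by simp
  show "y (g \<otimes> h) = y (h \<otimes> g) + y ?k"
    using y_mult[OF k'(1) hg] k' unfolding e by simp
  show "z (g \<otimes> h) = z (h \<otimes> g) + x ?k * y (h \<otimes> g) + z ?k"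
    using z_mult[OF k'(1) hg] k' unfolding e by simp
qed

lemma finite_bounded_unip:
  "finite {u \<in> unip. cmod (x u) \<le> R \<and> cmod (y u) \<le> R \<and> cmod (z u) \<le> R}"
  by (rule finite_of_bounds[of _ "max 1 R"]) (auto simp: unip_def)

text \<open>The inverse transpose, reflected in the antidiagonal: the action on the lines of the
  projective plane. It exchanges the conditions \<open>a = b\<close> and \<open>b = 1\<close>.\<close>

lemma triangular3_dual:
  "triangular3 G a (\<lambda>g. a g / b g) (\<lambda>g. - a g * y g / b g) (\<lambda>g. - x g / b g)
     (\<lambda>g. x g * y g / b g - z g)"
proof
  fix g h assume gh: "g \<in> carrier G" "h \<in> carrier G"
  note nz = nonzero[OF gh(1)] nonzero[OF gh(2)]
  show "a (g \<otimes> h) = a g * a h" by (rule a_mult[OF gh])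
  show "a (g \<otimes> h) / b (g \<otimes> h) = a g / b g * (a h / b h)" by (simp add: mults gh)
  show "- a (g \<otimes> h) * y (g \<otimes> h) / b (g \<otimes> h)
      = a g * (- a h * y h / b h) + - a g * y g / b g * (a h / b h)"
    using nz by (simp add: mults gh field_simps)
  show "- x (g \<otimes> h) / b (g \<otimes> h) = a g / b g * (- x h / b h) + - x g / b g"
    using nz by (simp add: mults gh field_simps)
  show "x (g \<otimes> h) * y (g \<otimes> h) / b (g \<otimes> h) - z (g \<otimes> h)
      = a g * (x h * y h / b h - z h) + - a g * y g / b g * (- x h / b h)
        + (x g * y g / b g - z g)"
    using nz by (simp add: mults gh field_simps)
next
  fix g assume "g \<in> carrier G"
  then show "a g \<noteq> 0 \<and> a g / b g \<noteq> 0" using nonzero[of g] by simp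
next
  fix R
  let ?E = "{g \<in> carrier G. cmod (a g) \<le> R \<and> cmod (1 / a g) \<le> R \<and> cmod (a g / b g) \<le> R \<and>
    cmod (1 / (a g / b g)) \<le> R \<and> cmod (- a g * y g / b g) \<le> R \<and> cmod (- x g / b g) \<le> R \<and>
    cmod (x g * y g / b g - z g) \<le> R}"
  show "finite ?E"
  proof (rule finite_of_bounds[of ?E "R * R * R + R"])
    fix g assume g: "g \<in> ?E"
    then have nz: "a g \<noteq> 0" "b g \<noteq> 0" using nonzero by auto
    have gb: "cmod (a g) \<le> R" "cmod (1 / a g) \<le> R" "cmod (a g / b g) \<le> R"
      "cmod (1 / (a g / b g)) \<le> R" "cmod (- a g * y g / b g) \<le> R" "cmod (- x g / b g) \<le> R"
      "cmod (x g * y g / b g - z g) \<le> R"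
      using g by blast+
    have R: "0 < cmod (a g)" "cmod (a g) \<le> R" "1 / cmod (a g) \<le> R"
      using gb(1,2) nz by (simp_all add: norm_divide)
    then have "0 < R" by linarith
    then have R1: "1 \<le> R"
    proof -
      have "1 = cmod (a g) * (1 / cmod (a g))" using nz by simp
      also have "\<dots> \<le> R * R" using R \<open>0 < R\<close> by (intro mult_mono) auto
      finally have "1 \<le> R\<^sup>2" by (simp add: power2_eq_square)
      then show ?thesis using \<open>0 < R\<close> power2_le_imp_le[of 1 R] by simp
    qed
    then have RR: "R \<le> R * R" "R * R \<le> R * R * R" "R \<le> R * R * R"
      using mult_mono[of 1 R R R] mult_mono[of 1 "R * R" R R] mult_mono[of 1 R "R * R" "R * R"]
      by (auto simp: mult.assoc intro: order_trans)
    have two: "cmod (c * d) \<le> R * R" if "cmod c \<le> R" "cmod d \<le> R" for c d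
      using that \<open>0 < R\<close> unfolding norm_mult by (intro mult_mono) auto
    have three: "cmod (c * d * e) \<le> R * R * R" if "cmod c \<le> R" "cmod d \<le> R" "cmod e \<le> R" for c d e
      using that two[of c d] \<open>0 < R\<close> unfolding norm_mult[of "c * d"] by (intro mult_mono) auto
    have "b g = a g * (1 / (a g / b g))" using nz by simp
    then have b: "cmod (b g) \<le> R * R" using two[OF gb(1,4)] by metis
    have "1 / b g = a g / b g * (1 / a g)" using nz by simp
    then have b': "cmod (1 / b g) \<le> R * R" using two[OF gb(3,2)] by metis
    have "cmod (y g) = cmod (- a g * y g / b g * (1 / (a g / b g)))"
      using nz by (simp add: norm_mult norm_divide)
    then have y: "cmod (y g) \<le> R * R" using two[OF gb(5,4)] by metis
    have "cmod (x g) = cmod (- x g / b g * a g * (1 / (a g / b g)))"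
      using nz by (simp add: norm_mult norm_divide)
    then have x: "cmod (x g) \<le> R * R * R"
      using three[OF gb(6,1,4)] by metis
    have "x g * y g / b g = - x g / b g * (- a g * y g / b g) * (1 / (a g / b g))"
      using nz by simp
    then have "cmod (x g * y g / b g) \<le> R * R * R"
      using three[OF gb(6,5,4)] by metis
    then have "cmod (z g) \<le> R * R * R + R"
      using norm_triangle_ineq4[of "x g * y g / b g" "x g * y g / b g - z g"] gb(7) by simp
    then show "cmod (a g) \<le> R * R * R + R \<and> cmod (1 / a g) \<le> R * R * R + R \<and>
        cmod (b g) \<le> R * R * R + R \<and> cmod (1 / b g) \<le> R * R * R + R \<and>
        cmod (x g) \<le> R * R * R + R \<and> cmod (y g) \<le> R * R * R + R \<and> cmod (z g) \<le> R * R * R + R"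
      using b b' x y gb(1,2) RR R1 by linarith
  qed auto
qed

text \<open>Here the group acts on the plane by affine maps with linear parts \<open>((a, x), (0, a))\<close>,
  which commute with each other. Its translations, by vectors \<open>(z, y)\<close>, are permuted by the
  linear parts. If these vectors span the plane, the linear parts form a discrete group. If they
  span a line, it consists of eigenvectors with eigenvalue \<open>a\<close>, which thus takes finitely many
  values. If there are no translations, the matrices commute, and unless \<open>a = 1\<close> throughout, \<open>y\<close>
  and \<open>z\<close> are functions of the linear part.\<close>

lemma noetherian_over_unip_if_a_eq_b:
  assumes D: "subgroup D G" and ab: "\<And>g. g \<in> D \<Longrightarrow> b g = a g"
  shows "noetherian_over G D unip"
proof -
  have Dc: "g \<in> carrier G" if "g \<in> D" for g using subgroup.mem_carrier[OF D that] .
  note Dcl = subgroup.m_closed[OF D] subgroup.m_inv_closed[OF D]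
  have via_linear_part: ?thesis
    if proper: "\<And>R. finite ((\<lambda>g. (a g, x g, a g)) `
      {g \<in> D. cmod (a g) \<le> R \<and> cmod (1 / a g) \<le> R \<and> cmod (x g) \<le> R \<and>
              cmod (a g) \<le> R \<and> cmod (1 / a g) \<le> R})"
  proof -
    interpret T: triangular2 G D a x a
      by (intro triangular2.intro triangular2_axioms.intro group_axioms D proper)
        (use Dc nonzero ab in \<open>simp_all add: mults\<close>)
    have "T.unip \<subseteq> unip" using ab Dc by (auto simp: T.unip_def unip_def)
    then show ?thesis by (intro noetherian_over_mono[OF T.noetherian_over_unip]) auto
  qed
  define L where "L = (\<lambda>u. (z u, y u)) ` {u \<in> D \<inter> unip. x u = 0}"
  have lf: "locally_finite L"
    unfolding locally_finite_def
  proof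
    fix R
    have "{v \<in> L. norm v \<le> R} \<subseteq>
        (\<lambda>u. (z u, y u)) ` {u \<in> unip. cmod (x u) \<le> max 0 R \<and> cmod (y u) \<le> max 0 R \<and> cmod (z u) \<le> max 0 R}"
    proof
      fix v assume v: "v \<in> {v \<in> L. norm v \<le> R}"
      then obtain u where u: "v = (z u, y u)" "u \<in> unip" "x u = 0" by (auto simp: L_def)
      then have "cmod (z u) \<le> R" "cmod (y u) \<le> R"
        using v norm_fst_le[of "z u" "y u"] norm_snd_le[of "y u" "z u"] by auto
      then show "v \<in> (\<lambda>u. (z u, y u)) ` {u \<in> unip. cmod (x u) \<le> max 0 R \<and>
          cmod (y u) \<le> max 0 R \<and> cmod (z u) \<le> max 0 R}"
        using u by auto
    qed
    then show "finite {v \<in> L. norm v \<le> R}"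
      using finite_bounded_unip[of "max 0 R"] finite_subset by blast
  qed
  have act: "(a g * v + x g * w, a g * w) \<in> L" if g: "g \<in> D" and vw: "(v, w) \<in> L" for g v w
  proof -
    obtain u where u: "u \<in> D" "u \<in> unip" "x u = 0" "v = z u" "w = y u"
      using vw by (auto simp: L_def)
    let ?c = "g \<otimes> u \<otimes> inv g"
    have "?c \<in> D" using g u Dcl by simp
    moreover have "x ?c = 0" "(z ?c, y ?c) = (a g * v + x g * w, a g * w)"
      using conj[OF Dc[OF g] u(2)] u ab[OF g] by simp_all
    ultimately show ?thesis
      using conj(1)[OF Dc[OF g] u(2)] unfolding L_def by (metis (mono_tags, lifting) IntI imageI mem_Collect_eq)
  qed
  consider (span) v w v' w' where "(v, w) \<in> L" "(v', w') \<in> L" "v * w' \<noteq> v' * w"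
    | (line) v w where "(v, w) \<in> L" "(v, w) \<noteq> (0, 0)"
        "\<And>v' w'. (v', w') \<in> L \<Longrightarrow> v * w' = v' * w"
    | (zero) "L \<subseteq> {(0, 0)}"
    by (metis (no_types, lifting) singletonI subrelI surj_pair)
  then show ?thesis
  proof cases
    case span
    show ?thesis
    proof (rule via_linear_part)
      fix R
      let ?T = "(\<lambda>g. (a g, x g, a g)) ` D"
      have "finite {(p, q, r) \<in> ?T. cmod p \<le> R \<and> cmod q \<le> R \<and> cmod r \<le> R}"
        by (rule finite_bounded_triangular_maps[OF lf span(3)]) (use act span(1,2) in auto)
      then show "finite ((\<lambda>g. (a g, x g, a g)) `
          {g \<in> D. cmod (a g) \<le> R \<and> cmod (1 / a g) \<le> R \<and> cmod (x g) \<le> R \<and>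
              cmod (a g) \<le> R \<and> cmod (1 / a g) \<le> R})"
        by (rule rev_finite_subset) auto
    qed
  next
    case line
    have fin: "finite (a ` D)"
    proof (rule finite_multipliers_pair[OF lf line(2)])
      fix c assume "c \<in> a ` D"
      then obtain g where g: "g \<in> D" "c = a g" by auto
      have m: "(a g * v + x g * w, a g * w) \<in> L" by (rule act[OF g(1) line(1)])
      have "v * (a g * w) = (a g * v + x g * w) * w" by (rule line(3)[OF m])
      then have xw: "x g * w = 0" by (simp add: algebra_simps)
      show "(c * v, c * w) \<in> L" using m unfolding xw g(2) by simp
      have "inverse c = a (inv g)" using g Dc invs by (simp add: inverse_eq_divide)
      then show "c \<noteq> 0 \<and> inverse c \<in> a ` D" using g Dc nonzero Dcl(2) by auto
    qed
    show ?thesis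
      by (rule noetherian_over_finite_values[OF fin])
        (use nonzero Dc ab in \<open>simp add: unip_def mults invs\<close>)
  next
    case zero
    have comm: "y (g \<otimes> h) = y (h \<otimes> g) \<and> z (g \<otimes> h) = z (h \<otimes> g)" if gh: "g \<in> D" "h \<in> D" for g h
    proof -
      let ?k = "g \<otimes> h \<otimes> inv (h \<otimes> g)"
      note c = commutator_unip[OF Dc[OF gh(1)] Dc[OF gh(2)]]
      have "x (g \<otimes> h) = x (h \<otimes> g)" using gh Dc ab by (simp add: mults)
      then have x: "x ?k = 0"
        using c(2) nonzero[of "h \<otimes> g"] Dc gh by simp
      moreover have "?k \<in> D" using gh Dcl by simp
      ultimately have "(z ?k, y ?k) \<in> L" using c(1) by (auto simp: L_def)
      then have "z ?k = 0" "y ?k = 0" using zero by auto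
      then show ?thesis using c x by simp
    qed
    show ?thesis
    proof (cases "\<forall>g\<in>D. a g = 1")
      case True
      then have "D \<subseteq> unip" using ab Dc by (auto simp: unip_def)
      then show ?thesis
        using Dcl by (intro noetherian_over_finite_values[of "\<lambda>_. ()"]) auto
    next
      case False
      then obtain g0 where g0: "g0 \<in> D" "a g0 \<noteq> 1" by blast
      define c where "c = 1 / (a g0 - 1)"
      have c: "c * (a g0 - 1) = 1" using g0 by (simp add: c_def)
      have y: "y g = c * y g0 * (a g - 1)" if "g \<in> D" for g
      proof -
        have "a g * y g0 + y g = a g0 * y g + y g0"
          using comm[OF that g0(1)] that g0 Dc ab by (simp add: mults)
        then have "y g * (a g0 - 1) = y g0 * (a g - 1)" by (simp add: algebra_simps)
        then have "c * (a g0 - 1) * y g = c * y g0 * (a g - 1)" by (simp add: mult_ac)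
        then show ?thesis using c by simp
      qed
      have z: "z g = c * (z g0 * (a g - 1) + x g * y g0 - x g0 * y g)" if "g \<in> D" for g
      proof -
        have "a g * z g0 + x g * y g0 + z g = a g0 * z g + x g0 * y g + z g0"
          using comm[OF that g0(1)] that g0 Dc by (simp add: mults)
        then have "z g * (a g0 - 1) = z g0 * (a g - 1) + x g * y g0 - x g0 * y g"
          by (simp add: algebra_simps)
        then have "c * (a g0 - 1) * z g = c * (z g0 * (a g - 1) + x g * y g0 - x g0 * y g)"
          by (metis mult.assoc mult.commute)
        then show ?thesis using c by simp
      qed
      show ?thesis
      proof (rule via_linear_part, rule finite_imageI)
        fix R
        let ?E = "{g \<in> D. cmod (a g) \<le> R \<and> cmod (1 / a g) \<le> R \<and> cmod (x g) \<le> R \<and>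
              cmod (a g) \<le> R \<and> cmod (1 / a g) \<le> R}"
        define Y where "Y = cmod (c * y g0) * (R + 1)"
        define Z where "Z = cmod c * (cmod (z g0) * (R + 1) + R * cmod (y g0) + cmod (x g0) * Y)"
        show "finite ?E"
        proof (rule finite_of_bounds[of ?E "max R (max Y Z)"])
          fix g assume g: "g \<in> ?E"
          then have "g \<in> D" "cmod (a g) \<le> R" "cmod (1 / a g) \<le> R" "cmod (x g) \<le> R" by auto
          have a1: "cmod (a g - 1) \<le> R + 1"
            using norm_triangle_ineq4[of "a g" 1] \<open>cmod (a g) \<le> R\<close> by simp
          have "cmod (y g) = cmod (c * y g0) * cmod (a g - 1)"
            unfolding y[OF \<open>g \<in> D\<close>] by (rule norm_mult)
          then have Y: "cmod (y g) \<le> Y" using a1 by (simp add: Y_def mult_left_mono)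
          have "cmod (z g0 * (a g - 1) + x g * y g0 - x g0 * y g)
              \<le> cmod (z g0 * (a g - 1)) + cmod (x g * y g0) + cmod (x g0 * y g)"
            by (meson add_right_mono norm_triangle_ineq norm_triangle_ineq4 order_trans)
          also have "\<dots> \<le> cmod (z g0) * (R + 1) + R * cmod (y g0) + cmod (x g0) * Y"
            unfolding norm_mult using a1 Y \<open>cmod (x g) \<le> R\<close>
            by (intro add_mono mult_left_mono mult_right_mono) auto
          finally have "cmod (z g) \<le> Z"
            unfolding z[OF \<open>g \<in> D\<close>] norm_mult[of c] Z_def by (rule mult_left_mono) simp
          then show "cmod (a g) \<le> max R (max Y Z) \<and> cmod (1 / a g) \<le> max R (max Y Z) \<and>
              cmod (b g) \<le> max R (max Y Z) \<and> cmod (1 / b g) \<le> max R (max Y Z) \<and>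
              cmod (x g) \<le> max R (max Y Z) \<and> cmod (y g) \<le> max R (max Y Z) \<and>
              cmod (z g) \<le> max R (max Y Z)"
            using g Y ab by auto
        qed (use Dc in auto)
      qed
    qed
  qed
qed

lemma noetherian_over_unip_if_b_eq_1:
  assumes D: "subgroup D G" and b: "\<And>g. g \<in> D \<Longrightarrow> b g = 1"
  shows "noetherian_over G D unip"
proof -
  interpret dual: triangular3 G a "\<lambda>g. a g / b g" "\<lambda>g. - a g * y g / b g" "\<lambda>g. - x g / b g"
    "\<lambda>g. x g * y g / b g - z g"
    by (rule triangular3_dual)
  have "dual.unip = unip" using nonzero by (auto simp: dual.unip_def unip_def)
  then show ?thesis using dual.noetherian_over_unip_if_a_eq_b[OF D] b by simp
qed

text \<open>The upper right entry of the logarithm of a unipotent matrix. Unlike \<open>z\<close>, it is additive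
  on commuting unipotent elements, and conjugation acts linearly on it.\<close>

definition zeta :: "'a \<Rightarrow> complex" where "zeta u = z u - x u * y u / 2"

text \<open>The commutators of \<open>w\<close> with \<open>u\<close> and with \<open>v\<close> have only a \<open>z\<close>-entry, which is linear in
  \<open>(x w, y w)\<close>. So a bound on \<open>(x w, y w)\<close> leaves finitely many such commutators, and the two of
  them determine \<open>(x w, y w)\<close>.\<close>

lemma locally_finite_xy:
  assumes u: "u \<in> unip" and v: "v \<in> unip" and uv: "x u * y v \<noteq> x v * y u"
  shows "locally_finite ((\<lambda>w. (x w, y w)) ` unip)"
  unfolding locally_finite_def
proof
  fix R
  define Z where "Z = z ` {k \<in> unip. x k = 0 \<and> y k = 0}"
  have Z: "finite {c \<in> Z. cmod c \<le> M}" for M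
  proof -
    have "{c \<in> Z. cmod c \<le> M} \<subseteq>
        z ` {u \<in> unip. cmod (x u) \<le> max 0 M \<and> cmod (y u) \<le> max 0 M \<and> cmod (z u) \<le> max 0 M}"
      by (auto simp: Z_def)
    then show ?thesis using finite_bounded_unip finite_subset by blast
  qed
  have comm: "x w * y u - x u * y w \<in> Z" if u: "u \<in> unip" and w: "w \<in> unip" for u w
  proof -
    note u' = unipD[OF u] and w' = unipD[OF w]
    let ?c = "w \<otimes> u \<otimes> inv w"
    note c = conj[OF w'(1) u]
    note c' = unipD[OF c(1)]
    have i: "inv u \<in> carrier G" using u' by simp
    have "?c \<otimes> inv u \<in> unip"
      using subgroup.m_closed[OF subgroup_unip c(1)] subgroup.m_inv_closed[OF subgroup_unip u] by simp
    moreover have "x (?c \<otimes> inv u) = 0" "y (?c \<otimes> inv u) = 0" "z (?c \<otimes> inv u) = x w * y u - x u * y w"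
      using x_mult[OF c'(1) i] y_mult[OF c'(1) i] z_mult[OF c'(1) i] u' w' c'(2,3) c(2-4)
      by (simp_all add: invs[OF u'(1)])
    ultimately show ?thesis unfolding Z_def by (metis (mono_tags, lifting) imageI mem_Collect_eq)
  qed
  define M where "M = R * (cmod (y u) + cmod (x u)) + R * (cmod (y v) + cmod (x v))"
  let ?f = "\<lambda>(X, Y). (X * y u - x u * Y, X * y v - x v * Y)"
  let ?K = "{p \<in> (\<lambda>w. (x w, y w)) ` unip. norm p \<le> R}"
  have "?f ` ?K \<subseteq> {c \<in> Z. cmod c \<le> M} \<times> {c \<in> Z. cmod c \<le> M}"
  proof (rule image_subsetI)
    fix p assume p: "p \<in> ?K"
    then obtain w where w: "w \<in> unip" "p = (x w, y w)" by blast
    then have b: "cmod (x w) \<le> R" "cmod (y w) \<le> R"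
      using p norm_fst_le[of "x w" "y w"] norm_snd_le[of "y w" "x w"] by auto
    then have "0 \<le> R" using norm_ge_zero order_trans by blast
    have m: "cmod (x w * Y - X * y w) \<le> R * (cmod Y + cmod X)" for X Y
    proof -
      have "cmod (x w * Y - X * y w) \<le> cmod (x w) * cmod Y + cmod X * cmod (y w)"
        using norm_triangle_ineq4[of "x w * Y" "X * y w"] by (simp add: norm_mult)
      also have "\<dots> \<le> R * cmod Y + cmod X * R"
        using b by (intro add_mono mult_left_mono mult_right_mono) auto
      finally show ?thesis by (simp add: algebra_simps)
    qed
    have "0 \<le> R * (cmod (y u) + cmod (x u))" "0 \<le> R * (cmod (y v) + cmod (x v))"
      using \<open>0 \<le> R\<close> by auto
    then have "cmod (x w * y u - x u * y w) \<le> M" "cmod (x w * y v - x v * y w) \<le> M"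
      using m[of "y u" "x u"] m[of "y v" "x v"] by (auto simp: M_def)
    then show "?f p \<in> {c \<in> Z. cmod c \<le> M} \<times> {c \<in> Z. cmod c \<le> M}"
      using comm[OF u w(1)] comm[OF v w(1)] w(2) by simp
  qed
  then have "finite (?f ` ?K)" by (rule finite_subset) (simp add: Z)
  moreover have "inj_on ?f ?K"
  proof (rule inj_onI)
    fix s t :: "complex \<times> complex" assume st: "?f s = ?f t"
    define X Y where "X = fst s - fst t" and "Y = snd s - snd t"
    have 1: "X * y u - x u * Y = 0" "X * y v - x v * Y = 0"
      using st by (auto simp: X_def Y_def split_beta algebra_simps)
    have "X * (x u * y v - x v * y u) = x u * (X * y v - x v * Y) - x v * (X * y u - x u * Y)"
      and "Y * (x u * y v - x v * y u) = y u * (X * y v - x v * Y) - y v * (X * y u - x u * Y)"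
      by (simp_all add: algebra_simps)
    then have "X = 0" "Y = 0" using 1 uv by auto
    then show "s = t" by (simp add: X_def Y_def prod_eq_iff)
  qed
  ultimately show "finite ?K" by (rule finite_imageD)
qed

lemma finite_bounded_zeta:
  "finite {u \<in> unip. cmod (x u) \<le> R \<and> cmod (y u) \<le> R \<and> cmod (zeta u) \<le> R}"
proof (rule finite_subset[OF _ finite_bounded_unip[of "R + R * R"]], clarify)
  fix u assume u: "u \<in> unip" "cmod (x u) \<le> R" "cmod (y u) \<le> R" "cmod (zeta u) \<le> R"
  then have "0 \<le> R" using norm_ge_zero order_trans by blast
  then have "cmod (x u) * cmod (y u) \<le> R * R" using u by (intro mult_mono) auto
  moreover have "cmod (z u) \<le> cmod (zeta u) + cmod (x u) * cmod (y u) / 2"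
    using norm_triangle_ineq[of "zeta u" "x u * y u / 2"] by (simp add: zeta_def norm_mult)
  moreover have "0 \<le> R * R" by simp
  ultimately have "cmod (x u) \<le> R + R * R" "cmod (y u) \<le> R + R * R" "cmod (z u) \<le> R + R * R"
    using u by linarith+
  then show "cmod (x u) \<le> R + R * R \<and> cmod (y u) \<le> R + R * R \<and> cmod (z u) \<le> R + R * R" by simp
qed

text \<open>The unipotent part lies in a Heisenberg group: if it is commutative, it is discrete in
  logarithmic coordinates; if not, both its image in the \<open>(x, y)\<close>-plane and its intersection
  with the centre are discrete.\<close>

lemma noetherian_over_unip_one: "noetherian_over G unip {\<one>}"
proof (cases "\<exists>u\<in>unip. \<exists>v\<in>unip. x u * y v \<noteq> x v * y u")
  case True
  then have lf: "locally_finite ((\<lambda>w. (x w, y w)) ` unip)" using locally_finite_xy by blast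
  let ?Z = "{k \<in> unip. x k = 0 \<and> y k = 0}"
  have Z: "subgroup ?Z G"
  proof (rule subgroupI)
    show "?Z \<noteq> {}" using ones subgroup.one_closed[OF subgroup_unip] by auto
  qed (use subgroup.m_closed[OF subgroup_unip] subgroup.m_inv_closed[OF subgroup_unip]
      in \<open>auto simp: unipD mults invs\<close>)
  have "noetherian_over G unip ?Z"
  proof (rule noetherian_over_proper_map[of unip "\<lambda>u. (x u, y u)" "\<lambda>u. (x u, y u)"])
    fix R
    have "(\<lambda>u. (x u, y u)) ` {g \<in> unip. norm (x g, y g) \<le> R}
        = {p \<in> (\<lambda>w. (x w, y w)) ` unip. norm p \<le> R}" by auto
    then show "finite ((\<lambda>u. (x u, y u)) ` {g \<in> unip. norm (x g, y g) \<le> R})"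
      using lf by (simp add: locally_finite_def)
  next
    fix g h assume "g \<in> unip" "h \<in> unip" "(x g, y g) = (x h, y h)"
    then show "inv g \<otimes> h \<in> ?Z"
      using subgroup.m_closed[OF subgroup_unip] subgroup.m_inv_closed[OF subgroup_unip]
      by (simp add: unipD mults invs)
  qed (simp add: unipD mults)
  moreover have "noetherian_over G ?Z {\<one>}"
  proof (rule noetherian_over_proper_map[of ?Z z "\<lambda>u. u"])
    fix R
    show "finite ((\<lambda>u. u) ` {g \<in> ?Z. norm (z g) \<le> R})"
      by (rule finite_subset[OF _ finite_bounded_unip[of "max 0 R"]]) auto
  qed (auto simp: unipD mults)
  ultimately show ?thesis using Z by (rule noetherian_over_trans)
next
  case False
  show ?thesis
  proof (rule noetherian_over_proper_map[of unip "\<lambda>u. (x u, y u, zeta u)" "\<lambda>u. u"])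
    fix g h assume gh: "g \<in> unip" "h \<in> unip"
    then have "x g * y h = x h * y g" using False by blast
    then show "(x (g \<otimes> h), y (g \<otimes> h), zeta (g \<otimes> h)) = (x g, y g, zeta g) + (x h, y h, zeta h)"
      using gh by (simp add: zeta_def unipD mults field_simps)
  next
    fix R
    show "finite ((\<lambda>u. u) ` {g \<in> unip. norm (x g, y g, zeta g) \<le> R})"
    proof (rule finite_subset[OF _ finite_bounded_zeta[of R]], clarify)
      fix g assume "norm (x g, y g, zeta g) \<le> R"
      then show "cmod (x g) \<le> R \<and> cmod (y g) \<le> R \<and> cmod (zeta g) \<le> R"
        using norm_fst_le[of "x g" "(y g, zeta g)"] norm_snd_le[of "(y g, zeta g)" "x g"]
          norm_fst_le[of "y g" "zeta g"] norm_snd_le[of "zeta g" "y g"] by linarith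
    qed
  qed (auto simp: unipD(1))
qed

text \<open>Conjugation acts on the entries \<open>(x, y)\<close> of unipotent elements by the diagonal matrices
  \<open>(a / b, b)\<close>. These entries form a discrete spanning set, so the diagonal matrices form a
  discrete group.\<close>

lemma noetherian_over_unip_if_noncommuting:
  assumes u: "u \<in> unip" and v: "v \<in> unip" and uv: "x u * y v \<noteq> x v * y u"
  shows "noetherian_over G (carrier G) unip"
proof -
  let ?P = "(\<lambda>w. (x w, y w)) ` unip"
  have act: "(a g / b g * x w + 0 * y w, b g * y w) \<in> ?P" if "g \<in> carrier G" "w \<in> unip" for g w
    using conj[OF that] by (auto intro!: image_eqI[of _ _ "g \<otimes> w \<otimes> inv g"])
  interpret T: triangular2 G "carrier G" "\<lambda>g. a g / b g" "\<lambda>_. 0" b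
  proof (intro triangular2.intro triangular2_axioms.intro group_axioms subgroup_self)
    fix R
    let ?T = "(\<lambda>g. (a g / b g, 0, b g)) ` carrier G"
    have "finite {(p, q, r) \<in> ?T. cmod p \<le> R \<and> cmod q \<le> R \<and> cmod r \<le> R}"
      by (rule finite_bounded_triangular_maps[OF locally_finite_xy[OF u v uv] uv])
        (use act u v in auto)
    then show "finite ((\<lambda>g. (a g / b g, 0 :: complex, b g)) ` {g \<in> carrier G. cmod (a g / b g) \<le> R \<and>
        cmod (1 / (a g / b g)) \<le> R \<and> cmod (0 :: complex) \<le> R \<and> cmod (b g) \<le> R \<and> cmod (1 / b g) \<le> R})"
      by (rule rev_finite_subset) auto
  qed (simp_all add: nonzero mults)
  have "T.unip \<subseteq> unip" using nonzero by (auto simp: T.unip_def unip_def)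
  then show ?thesis by (intro noetherian_over_mono[OF T.noetherian_over_unip]) auto
qed

text \<open>Here all unipotent elements have \<open>(x, y)\<close> on one line. Conjugation acts on their pairs
  \<open>(\<zeta>, t)\<close>, where \<open>t\<close> is the coordinate on that line, by triangular matrices with diagonal
  \<open>(a, \<chi>)\<close>; here \<open>\<chi>\<close> is \<open>b\<close> or \<open>a / b\<close>. If the pairs span the plane, these matrices form a
  discrete group; otherwise \<open>\<chi>\<close> takes finitely many values, and is trivial on a subgroup of
  finite index of one of the two kinds above.\<close>

lemma noetherian_over_unip_if_collinear:
  assumes comm: "\<And>u v. u \<in> unip \<Longrightarrow> v \<in> unip \<Longrightarrow> x u * y v = x v * y u"
    and u0: "u0 \<in> unip" "(x u0, y u0) \<noteq> (0, 0)"
  shows "noetherian_over G (carrier G) unip"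
proof -
  define \<alpha> where "\<alpha> = x u0"
  define \<beta> where "\<beta> = y u0"
  define t where "t u = (if \<beta> \<noteq> 0 then y u / \<beta> else x u / \<alpha>)" for u
  define chi where "chi g = (if \<beta> \<noteq> 0 then b g else a g / b g)" for g
  define q where "q g = x g * \<beta> - a g / b g * y g * \<alpha>" for g
  have nz: "\<alpha> \<noteq> 0 \<or> \<beta> \<noteq> 0" using u0(2) by (auto simp: \<alpha>_def \<beta>_def)
  have xt: "x u = t u * \<alpha>" and yt: "y u = t u * \<beta>" if "u \<in> unip" for u
    using comm[OF that u0(1)] nz by (auto simp: t_def \<alpha>_def[symmetric] \<beta>_def[symmetric] field_simps)
  \<comment> \<open>Conjugation preserves the line through \<open>(\<alpha>, \<beta>)\<close>, which is not an eigenline unless the two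
    multipliers agree.\<close>
  have both: "a g / b g = b g" if "\<alpha> \<noteq> 0" "\<beta> \<noteq> 0" "g \<in> carrier G" for g
  proof -
    note c = conj[OF that(3) u0(1)]
    have "a g / b g * \<alpha> * \<beta> = \<alpha> * (b g * \<beta>)"
      using comm[OF c(1) u0(1)] c by (simp add: \<alpha>_def \<beta>_def)
    then have "a g / b g * (\<alpha> * \<beta>) = b g * (\<alpha> * \<beta>)" by (simp only: mult_ac)
    then show ?thesis using that unfolding mult_cancel_right by simp
  qed
  have t_conj: "t (g \<otimes> u \<otimes> inv g) = chi g * t u" if "g \<in> carrier G" "u \<in> unip" for g u
    using conj[OF that] by (simp add: t_def chi_def)
  have zeta_conj: "zeta (g \<otimes> u \<otimes> inv g) = a g * zeta u + q g * t u"
    if g: "g \<in> carrier G" and u: "u \<in> unip" for g u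
  proof -
    note c = conj[OF g u]
    have "zeta (g \<otimes> u \<otimes> inv g) = a g * zeta u + x g * y u - a g / b g * x u * y g"
      using nonzero[OF g] by (simp add: zeta_def c field_simps)
    then show ?thesis using xt[OF u] yt[OF u] by (simp add: q_def algebra_simps)
  qed
  define L where "L = (\<lambda>u. (zeta u, t u)) ` unip"
  have lf: "locally_finite L"
    unfolding locally_finite_def
  proof
    fix R
    define M where "M = R * cmod \<alpha> + R * cmod \<beta> + R"
    have "{v \<in> L. norm v \<le> R} \<subseteq>
        (\<lambda>u. (zeta u, t u)) ` {u \<in> unip. cmod (x u) \<le> M \<and> cmod (y u) \<le> M \<and> cmod (zeta u) \<le> M}"
    proof
      fix v assume v: "v \<in> {v \<in> L. norm v \<le> R}"
      then obtain u where u: "v = (zeta u, t u)" "u \<in> unip" by (auto simp: L_def)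
      then have zt: "cmod (zeta u) \<le> R" "cmod (t u) \<le> R"
        using v norm_fst_le[of "zeta u" "t u"] norm_snd_le[of "t u" "zeta u"] by auto
      then have "0 \<le> R" using norm_ge_zero order_trans by blast
      then have "0 \<le> R * cmod \<alpha>" "0 \<le> R * cmod \<beta>" by auto
      moreover have "cmod (x u) \<le> R * cmod \<alpha>" "cmod (y u) \<le> R * cmod \<beta>"
        using zt unfolding xt[OF u(2)] yt[OF u(2)] norm_mult by (auto intro: mult_right_mono)
      ultimately have "cmod (x u) \<le> M" "cmod (y u) \<le> M" "cmod (zeta u) \<le> M"
        using zt \<open>0 \<le> R\<close> unfolding M_def by linarith+
      then show "v \<in> (\<lambda>u. (zeta u, t u)) `
          {u \<in> unip. cmod (x u) \<le> M \<and> cmod (y u) \<le> M \<and> cmod (zeta u) \<le> M}"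
        using u by auto
    qed
    then show "finite {v \<in> L. norm v \<le> R}"
      using finite_bounded_zeta[of M] finite_subset by blast
  qed
  have act: "(a g * v + q g * w, chi g * w) \<in> L" if g: "g \<in> carrier G" and vw: "(v, w) \<in> L" for g v w
  proof -
    obtain u where u: "u \<in> unip" "v = zeta u" "w = t u" using vw by (auto simp: L_def)
    show ?thesis
      unfolding L_def u zeta_conj[OF g u(1), symmetric] t_conj[OF g u(1), symmetric]
      by (rule imageI) (rule conj(1)[OF g u(1)])
  qed
  have chi_mult: "chi (g \<otimes> h) = chi g * chi h" if "g \<in> carrier G" "h \<in> carrier G" for g h
    using that by (simp add: chi_def mults)
  have chi_inv: "chi (inv g) = inverse (chi g)" and chi_nz: "chi g \<noteq> 0" if "g \<in> carrier G" for g
    using that nonzero[OF that] by (auto simp: chi_def invs field_simps)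
  show ?thesis
  proof (cases "\<exists>v w v' w'. (v, w) \<in> L \<and> (v', w') \<in> L \<and> v * w' \<noteq> v' * w")
    case True
    then obtain v w v' w' where vw: "(v, w) \<in> L" "(v', w') \<in> L" "v * w' \<noteq> v' * w" by blast
    interpret T: triangular2 G "carrier G" a q chi
    proof (intro triangular2.intro triangular2_axioms.intro group_axioms subgroup_self)
      fix g h assume g: "g \<in> carrier G" and h: "h \<in> carrier G"
      have "x g * b h * \<beta> - a g * a h / (b g * b h) * y g * \<alpha> = q g * chi h"
      proof (cases "\<beta> = 0")
        case True
        then show ?thesis by (simp add: q_def chi_def field_simps)
      next
        case b: False
        show ?thesis
        proof (cases "\<alpha> = 0")
          case True
          with b show ?thesis by (simp add: q_def chi_def)
        next
          case False
          have "a g * a h / (b g * b h) = a g / b g * (a h / b h)" by simp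
          also have "\<dots> = a g / b g * b h" using both[OF False b h] by simp
          finally show ?thesis using b by (simp add: q_def chi_def algebra_simps)
        qed
      qed
      moreover have "q (g \<otimes> h) = a g * q h + (x g * b h * \<beta> - a g * a h / (b g * b h) * y g * \<alpha>)"
        using nonzero[OF g] nonzero[OF h] g h by (simp add: q_def mults field_simps)
      ultimately show "q (g \<otimes> h) = a g * q h + q g * chi h" by simp
    next
      fix R
      let ?T = "(\<lambda>g. (a g, q g, chi g)) ` carrier G"
      have "finite {(p, q, r) \<in> ?T. cmod p \<le> R \<and> cmod q \<le> R \<and> cmod r \<le> R}"
        by (rule finite_bounded_triangular_maps[OF lf vw(3)]) (use act vw(1,2) in auto)
      then show "finite ((\<lambda>g. (a g, q g, chi g)) ` {g \<in> carrier G. cmod (a g) \<le> R \<and>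
          cmod (1 / a g) \<le> R \<and> cmod (q g) \<le> R \<and> cmod (chi g) \<le> R \<and> cmod (1 / chi g) \<le> R})"
        by (rule rev_finite_subset) auto
    qed (simp_all add: nonzero a_mult chi_mult chi_nz)
    have "T.unip \<subseteq> unip"
    proof
      fix g assume "g \<in> T.unip"
      then have g: "g \<in> carrier G" "a g = 1" "chi g = 1" by (auto simp: T.unip_def)
      then show "g \<in> unip" using nonzero[OF g(1)] by (simp add: unip_def chi_def split: if_splits)
    qed
    then show ?thesis by (intro noetherian_over_mono[OF T.noetherian_over_unip]) auto
  next
    case False
    have t0: "t u0 = 1" using nz by (auto simp: t_def \<alpha>_def \<beta>_def)
    have m0: "(zeta u0, t u0) \<in> L" using u0(1) by (auto simp: L_def)
    have fin: "finite (chi ` carrier G)"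
    proof (rule finite_multipliers_pair[OF lf, of "zeta u0" "t u0"])
      fix c assume "c \<in> chi ` carrier G"
      then obtain g where g: "g \<in> carrier G" "c = chi g" by auto
      have m: "(a g * zeta u0 + q g * t u0, chi g * t u0) \<in> L" by (rule act[OF g(1) m0])
      then have "(a g * zeta u0 + q g * t u0) * t u0 = zeta u0 * (chi g * t u0)"
        using m0 False by metis
      then have "a g * zeta u0 + q g * t u0 = c * zeta u0" using t0 g by simp
      then show "(c * zeta u0, c * t u0) \<in> L" using m g by simp
      show "c \<noteq> 0 \<and> inverse c \<in> chi ` carrier G"
        using g chi_nz chi_inv by (metis imageI inv_closed)
    qed (simp add: t0)
    let ?D = "{g \<in> carrier G. chi g = 1}"
    have D: "subgroup ?D G"
    proof (rule subgroupI)
      show "?D \<noteq> {}" using ones by (auto simp: chi_def)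
    qed (auto simp: chi_mult chi_inv)
    have "noetherian_over G (carrier G) ?D"
      by (rule noetherian_over_finite_values[OF fin]) (auto simp: chi_mult chi_inv chi_nz)
    moreover have "noetherian_over G ?D unip"
    proof (cases "\<beta> = 0")
      case True
      show ?thesis
        by (rule noetherian_over_unip_if_a_eq_b[OF D]) (use True nonzero in \<open>auto simp: chi_def\<close>)
    next
      case False
      show ?thesis
        by (rule noetherian_over_unip_if_b_eq_1[OF D]) (use False in \<open>auto simp: chi_def\<close>)
    qed
    ultimately show ?thesis using D by (rule noetherian_over_trans)
  qed
qed

text \<open>All commutators have only a \<open>z\<close>-entry. Commuting with \<open>g0\<close> modulo such elements forces
  \<open>x = c (b - a)\<close> and \<open>y = d (b - 1)\<close> with constants \<open>c\<close> and \<open>d\<close>. A unipotent change of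
  coordinates makes these entries vanish on the whole group and turns \<open>z\<close> into
  \<open>z - c d (b - 1)\<close>. With this new entry, \<open>((a, z), (0, 1))\<close> is a homomorphism; scaling it by
  \<open>b\<close> also keeps track of the entry \<open>b\<close>.\<close>

lemma noetherian_over_unip_if_central:
  assumes U: "\<And>u. u \<in> unip \<Longrightarrow> x u = 0 \<and> y u = 0"
    and g0: "g0 \<in> carrier G" "a g0 \<noteq> b g0" "b g0 \<noteq> 1"
  shows "noetherian_over G (carrier G) unip"
proof -
  define c where "c = x g0 / (b g0 - a g0)"
  define d where "d = y g0 / (b g0 - 1)"
  have x: "x g = c * (b g - a g)" and y: "y g = d * (b g - 1)" if g: "g \<in> carrier G" for g
  proof -
    note k = commutator_unip[OF g g0(1)]
    have "x (g \<otimes> g0) = x (g0 \<otimes> g)" "y (g \<otimes> g0) = y (g0 \<otimes> g)" using k U[OF k(1)] by simp_all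
    then have "a g * x g0 + x g * b g0 = a g0 * x g + x g0 * b g" "b g * y g0 + y g = b g0 * y g + y g0"
      using g g0 by (simp_all add: x_mult y_mult)
    then have "x g * (b g0 - a g0) = x g0 * (b g - a g)" "y g * (b g0 - 1) = y g0 * (b g - 1)"
      by (simp_all add: algebra_simps)
    then show "x g = c * (b g - a g)" "y g = d * (b g - 1)"
      using g0 by (simp_all add: c_def d_def field_simps)
  qed
  define q where "q g = (z g - c * d * (b g - 1)) * b g" for g
  interpret T: triangular2 G "carrier G" "\<lambda>g. a g * b g" q b
  proof (intro triangular2.intro triangular2_axioms.intro group_axioms subgroup_self)
    fix g h assume gh: "g \<in> carrier G" "h \<in> carrier G"
    then have "q (g \<otimes> h) = (a g * z h + c * (b g - a g) * (d * (b h - 1)) + z g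
        - c * d * (b g * b h - 1)) * (b g * b h)"
      by (simp add: q_def z_mult b_mult x[OF gh(1)] y[OF gh(2)])
    also have "\<dots> = a g * b g * q h + q g * b h" by (simp add: q_def algebra_simps)
    finally show "q (g \<otimes> h) = a g * b g * q h + q g * b h" .
  next
    fix R
    let ?E = "{g \<in> carrier G. cmod (a g * b g) \<le> R \<and> cmod (1 / (a g * b g)) \<le> R \<and> cmod (q g) \<le> R \<and>
        cmod (b g) \<le> R \<and> cmod (1 / b g) \<le> R}"
    define X where "X = cmod c * (R + R * R)"
    define Y where "Y = cmod d * (R + 1)"
    define Z where "Z = R * R + cmod (c * d) * (R + 1)"
    have "finite ?E"
    proof (rule finite_of_bounds[of ?E "R + R * R + X + Y + Z"])
      fix g assume g: "g \<in> ?E"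
      then have gc: "g \<in> carrier G" by simp
      have gb: "cmod (a g * b g) \<le> R" "cmod (1 / (a g * b g)) \<le> R" "cmod (q g) \<le> R"
        "cmod (b g) \<le> R" "cmod (1 / b g) \<le> R" using g by blast+
      note nz = nonzero[OF gc]
      have R: "0 \<le> R" using gb(4) norm_ge_zero order_trans by blast
      have two: "cmod (v * w) \<le> R * R" if "cmod v \<le> R" "cmod w \<le> R" for v w
        using that R unfolding norm_mult by (intro mult_mono) auto
      have "a g = a g * b g * (1 / b g)" "1 / a g = 1 / (a g * b g) * b g"
        "z g - c * d * (b g - 1) = q g * (1 / b g)"
        using nz by (simp_all add: q_def)
      then have a: "cmod (a g) \<le> R * R" and a': "cmod (1 / a g) \<le> R * R"
        and z: "cmod (z g - c * d * (b g - 1)) \<le> R * R"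
        using two[OF gb(1,5)] two[OF gb(2,4)] two[OF gb(3,5)] by metis+
      have b1: "cmod (b g - 1) \<le> R + 1" using norm_triangle_ineq4[of "b g" 1] gb(4) by simp
      have "cmod (b g - a g) \<le> R + R * R" using norm_triangle_ineq4[of "b g" "a g"] gb(4) a by linarith
      then have "cmod (x g) \<le> X" unfolding x[OF gc] norm_mult X_def by (rule mult_left_mono) simp
      moreover have "cmod (y g) \<le> Y" using b1 unfolding y[OF gc] norm_mult Y_def by (rule mult_left_mono) simp
      moreover have "cmod (c * d * (b g - 1)) \<le> cmod (c * d) * (R + 1)"
        using b1 unfolding norm_mult[of "c * d"] by (rule mult_left_mono) simp
      then have "cmod (z g) \<le> Z"
        using norm_triangle_ineq[of "z g - c * d * (b g - 1)" "c * d * (b g - 1)"] z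
        unfolding Z_def by simp
      moreover have "0 \<le> X" "0 \<le> Y" "0 \<le> Z" "0 \<le> R * R" using R by (auto simp: X_def Y_def Z_def)
      ultimately show "cmod (a g) \<le> R + R * R + X + Y + Z \<and> cmod (1 / a g) \<le> R + R * R + X + Y + Z \<and>
          cmod (b g) \<le> R + R * R + X + Y + Z \<and> cmod (1 / b g) \<le> R + R * R + X + Y + Z \<and>
          cmod (x g) \<le> R + R * R + X + Y + Z \<and> cmod (y g) \<le> R + R * R + X + Y + Z \<and>
          cmod (z g) \<le> R + R * R + X + Y + Z"
        using a a' gb(4,5) R by linarith
    qed auto
    then show "finite ((\<lambda>g. (a g * b g, q g, b g)) ` ?E)" by (rule finite_imageI)
  qed (simp_all add: nonzero a_mult b_mult)
  have "T.unip \<subseteq> unip" by (auto simp: T.unip_def unip_def)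
  then show ?thesis by (intro noetherian_over_mono[OF T.noetherian_over_unip]) auto
qed

lemma noetherian_over_unip: "noetherian_over G (carrier G) unip"
proof -
  consider (noncomm) u v where "u \<in> unip" "v \<in> unip" "x u * y v \<noteq> x v * y u"
    | (line) u0 where "\<And>u v. u \<in> unip \<Longrightarrow> v \<in> unip \<Longrightarrow> x u * y v = x v * y u"
        "u0 \<in> unip" "(x u0, y u0) \<noteq> (0, 0)"
    | (central) "\<And>u. u \<in> unip \<Longrightarrow> x u = 0 \<and> y u = 0"
    by (metis prod.inject)
  then show ?thesis
  proof cases
    case noncomm
    then show ?thesis by (rule noetherian_over_unip_if_noncommuting)
  next
    case line
    then show ?thesis by (rule noetherian_over_unip_if_collinear)
  next
    case central
    show ?thesis
    proof (cases "\<exists>g\<in>carrier G. a g \<noteq> b g \<and> b g \<noteq> 1")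
      case True
      then show ?thesis using noetherian_over_unip_if_central central by blast
    next
      case False
      \<comment> \<open>A group is not the union of two proper subgroups.\<close>
      have "(\<forall>g\<in>carrier G. b g = a g) \<or> (\<forall>g\<in>carrier G. b g = 1)"
      proof (rule ccontr)
        assume "\<not> ?thesis"
        then obtain g h where g: "g \<in> carrier G" "b g \<noteq> a g" and h: "h \<in> carrier G" "b h \<noteq> 1"
          by blast
        then have "b g = 1" "a h = b h" using False by metis+
        then have "a (g \<otimes> h) \<noteq> b (g \<otimes> h)" "b (g \<otimes> h) \<noteq> 1"
          using g h nonzero[OF h(1)] by (auto simp: mults)
        then show False using False g h by blast
      qed
      then show ?thesis
        using noetherian_over_unip_if_a_eq_b[OF subgroup_self]
          noetherian_over_unip_if_b_eq_1[OF subgroup_self] by blast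
    qed
  qed
qed

theorem noetherian: "noetherian_over G (carrier G) {\<one>}"
  by (rule noetherian_over_trans[OF noetherian_over_unip noetherian_over_unip_one subgroup_unip])

end

section \<open>Minimal generating sets of torsion-free abelian groups\<close>

context comm_group
begin

lemma generate_eq_power_products:
  assumes T: "finite T" "T \<subseteq> carrier G"
  shows "g \<in> generate G T \<Longrightarrow> \<exists>c::'a \<Rightarrow> int. g = (\<Otimes>t\<in>T. t [^] c t)"
proof (induction rule: generate.induct)
  case one
  have "\<one> = (\<Otimes>t\<in>T. t [^] (0::int))" by simp
  then show ?case by (intro exI[of _ "\<lambda>_. 0"])
next
  case (incl h)
  have "(\<Otimes>t\<in>T. t [^] (if t = h then 1 else 0 :: int)) = (\<Otimes>t\<in>T. if h = t then t else \<one>)"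
    using T by (intro finprod_cong) (auto simp: subset_iff simp_implies_def)
  also have "\<dots> = h" using incl T by (subst finprod_singleton) (auto simp: Pi_def)
  finally show ?case by (intro exI[of _ "\<lambda>t. if t = h then 1 else 0"]) simp
next
  case (inv h)
  have "(\<Otimes>t\<in>T. t [^] (if t = h then - 1 else 0 :: int)) = (\<Otimes>t\<in>T. if h = t then inv t else \<one>)"
    using T by (intro finprod_cong) (auto simp: subset_iff int_pow_neg simp_implies_def)
  also have "\<dots> = inv h" using inv T by (subst finprod_singleton) (auto simp: Pi_def)
  finally show ?case by (intro exI[of _ "\<lambda>t. if t = h then - 1 else 0"]) simp
next
  case (eng h1 h2)
  then obtain c1 c2 :: "'a \<Rightarrow> int"
    where c: "h1 = (\<Otimes>t\<in>T. t [^] c1 t)" "h2 = (\<Otimes>t\<in>T. t [^] c2 t)" by blast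
  have "h1 \<otimes> h2 = (\<Otimes>t\<in>T. t [^] c1 t \<otimes> t [^] c2 t)"
    unfolding c using T by (subst finprod_multf) auto
  also have "\<dots> = (\<Otimes>t\<in>T. t [^] (c1 t + c2 t))"
    using T by (intro finprod_cong) (auto simp: int_pow_mult subset_iff)
  finally show ?case by (intro exI[of _ "\<lambda>t. c1 t + c2 t"])
qed

text \<open>The Euclidean algorithm on the exponents of a relation: as long as two of them are
  nonzero, a change of generators \<open>h j \<mapsto> h j \<otimes> h i [^] s\<close> with \<open>s = 1\<close> or \<open>s = - 1\<close> reduces the
  larger one. When a single exponent is left, its generator is a torsion element and can be
  dropped.\<close>

lemma relation_drops_generator:
  fixes k :: "'i \<Rightarrow> int"
  assumes tf: "\<And>x n::nat. x \<in> carrier G \<Longrightarrow> n > 0 \<Longrightarrow> x [^] n = \<one> \<Longrightarrow> x = \<one>"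
    and I: "finite I" and h: "h \<in> I \<rightarrow> carrier G"
    and rel: "(\<Otimes>i\<in>I. h i [^] k i) = \<one>" and nz: "\<exists>i\<in>I. k i \<noteq> 0"
  shows "\<exists>h' j. j \<in> I \<and> h' \<in> I \<rightarrow> carrier G \<and> generate G (h' ` (I - {j})) = generate G (h ` I)"
  using h rel nz
proof (induction "\<Sum>i\<in>I. nat \<bar>k i\<bar>" arbitrary: h k rule: less_induct)
  case less
  have hc: "h i \<in> carrier G" if "i \<in> I" for i using less.prems(1) that by blast
  obtain i0 where i0: "i0 \<in> I" "k i0 \<noteq> 0" using less.prems(3) by blast
  show ?case
  proof (cases "\<exists>j\<in>I. j \<noteq> i0 \<and> k j \<noteq> 0")
    case False
    have "(\<Otimes>i\<in>I. h i [^] k i) = (\<Otimes>i\<in>I. if i0 = i then h i [^] k i else \<one>)"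
      using False hc by (intro finprod_cong) (auto simp: simp_implies_def)
    also have "\<dots> = h i0 [^] k i0"
      using i0 I hc by (subst finprod_singleton) (auto simp: Pi_def)
    finally have p: "h i0 [^] k i0 = \<one>" using less.prems(2) by simp
    have "h i0 [^] nat \<bar>k i0\<bar> = h i0 [^] \<bar>k i0\<bar>" by (simp add: int_pow_def2 del: pow_nat)
    also have "\<dots> = \<one>"
      using p hc[OF i0(1)] by (cases "k i0 \<ge> 0") (simp_all add: int_pow_neg)
    finally have h1: "h i0 = \<one>" using tf[OF hc[OF i0(1)], of "nat \<bar>k i0\<bar>"] i0 by simp
    have "h ` I \<subseteq> carrier G" using hc by blast
    then have sub: "subgroup (generate G (h ` (I - {i0}))) G"
      by (intro generate_is_subgroup) blast
    have "h ` I \<subseteq> generate G (h ` (I - {i0}))"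
    proof (rule image_subsetI)
      fix i assume "i \<in> I"
      then show "h i \<in> generate G (h ` (I - {i0}))"
        using h1 by (cases "i = i0") (auto intro: generate.incl generate.one)
    qed
    then have "generate G (h ` I) \<subseteq> generate G (h ` (I - {i0}))"
      by (rule generate_subgroup_incl[OF _ sub])
    moreover have "generate G (h ` (I - {i0})) \<subseteq> generate G (h ` I)"
      by (rule mono_generate) blast
    ultimately have "generate G (h ` (I - {i0})) = generate G (h ` I)" by (rule subset_antisym[rotated])
    then show ?thesis using i0(1) less.prems(1) by (intro exI[of _ h] exI[of _ i0] conjI)
  next
    case True
    then obtain i j where ij: "i \<in> I" "j \<in> I" "i \<noteq> j" "k i \<noteq> 0" "k j \<noteq> 0" "\<bar>k j\<bar> \<le> \<bar>k i\<bar>"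
      using i0 by (metis linorder_le_cases)
    define s where "s = sgn (k i) * sgn (k j)"
    have s: "s * s = 1" using ij by (simp add: s_def sgn_if)
    have small: "\<bar>k i - s * k j\<bar> < \<bar>k i\<bar>" using ij by (auto simp: s_def sgn_if)
    define h' where "h' = h(j := h j \<otimes> h i [^] s)"
    define k' where "k' = k(i := k i - s * k j)"
    have h': "h' \<in> I \<rightarrow> carrier G" using less.prems(1) ij by (auto simp: h'_def Pi_iff)
    let ?J = "I - {i, j}"
    have split: "(\<Otimes>i\<in>I. u i) = u i \<otimes> (u j \<otimes> (\<Otimes>i\<in>?J. u i))" if "u \<in> I \<rightarrow> carrier G" for u
    proof -
      have "I = insert i (insert j ?J)" using ij by blast
      moreover have "(\<Otimes>i\<in>insert i (insert j ?J). u i) = u i \<otimes> (u j \<otimes> (\<Otimes>i\<in>?J. u i))"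
        using I that ij by (subst finprod_insert; (subst finprod_insert)?) (auto simp: Pi_iff)
      ultimately show ?thesis by simp
    qed
    have "(\<Otimes>i\<in>?J. h' i [^] k' i) = (\<Otimes>i\<in>?J. h i [^] k i)"
      using hc by (intro finprod_cong) (auto simp: h'_def k'_def)
    moreover have "h' i [^] k' i \<otimes> (h' j [^] k' j \<otimes> w) = h i [^] k i \<otimes> (h j [^] k j \<otimes> w)"
      if "w \<in> carrier G" for w
    proof -
      have "h' i [^] k' i \<otimes> (h' j [^] k' j \<otimes> w)
          = h i [^] (k i - s * k j) \<otimes> ((h j [^] k j \<otimes> h i [^] (s * k j)) \<otimes> w)"
        using ij hc by (simp add: h'_def k'_def int_pow_distrib int_pow_pow)
      also have "\<dots> = (h i [^] (k i - s * k j) \<otimes> h i [^] (s * k j)) \<otimes> (h j [^] k j \<otimes> w)"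
        using ij hc that by (simp add: m_ac)
      also have "h i [^] (k i - s * k j) \<otimes> h i [^] (s * k j) = h i [^] k i"
        using ij hc by (simp add: int_pow_mult[symmetric])
      finally show ?thesis .
    qed
    moreover have "(\<Otimes>i\<in>?J. h i [^] k i) \<in> carrier G" using hc by (intro finprod_closed) auto
    moreover have "(\<lambda>i. h' i [^] k' i) \<in> I \<rightarrow> carrier G" "(\<lambda>i. h i [^] k i) \<in> I \<rightarrow> carrier G"
      using h' hc by (auto simp: Pi_iff)
    ultimately have rel': "(\<Otimes>i\<in>I. h' i [^] k' i) = \<one>"
      using less.prems(2) split[of "\<lambda>i. h' i [^] k' i"] split[of "\<lambda>i. h i [^] k i"] by simp
    have "(\<Sum>i\<in>I. nat \<bar>k' i\<bar>) < (\<Sum>i\<in>I. nat \<bar>k i\<bar>)"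
    proof (rule sum_strict_mono_ex1[OF I])
      show "\<forall>l\<in>I. nat \<bar>k' l\<bar> \<le> nat \<bar>k l\<bar>" using small by (auto simp: k'_def)
      show "\<exists>l\<in>I. nat \<bar>k' l\<bar> < nat \<bar>k l\<bar>" using small ij by (intro bexI[of _ i]) (auto simp: k'_def)
    qed
    moreover have "\<exists>l\<in>I. k' l \<noteq> 0" using ij by (intro bexI[of _ j]) (auto simp: k'_def)
    ultimately obtain f l where f: "l \<in> I" "f \<in> I \<rightarrow> carrier G"
        "generate G (f ` (I - {l})) = generate G (h' ` I)"
      using less.hyps[OF _ h' rel'] by blast
    have c: "h ` I \<subseteq> carrier G" "h' ` I \<subseteq> carrier G" using hc h' by auto
    note sub = generate_is_subgroup[OF c(1)] generate_is_subgroup[OF c(2)]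
    have "h' ` I \<subseteq> generate G (h ` I)"
    proof (rule image_subsetI)
      fix l assume "l \<in> I"
      then have "h l \<in> generate G (h ` I)" "h i [^] s \<in> generate G (h ` I)"
        using ij by (auto intro!: generate.incl subgroup_int_pow_closed[OF sub(1)])
      then show "h' l \<in> generate G (h ` I)" by (auto simp: h'_def intro: generate.eng)
    qed
    then have 1: "generate G (h' ` I) \<subseteq> generate G (h ` I)"
      by (rule generate_subgroup_incl[OF _ sub(1)])
    have "h ` I \<subseteq> generate G (h' ` I)"
    proof (rule image_subsetI)
      fix l assume l: "l \<in> I"
      then have hl: "h' l \<in> generate G (h' ` I)" by (auto intro: generate.incl)
      show "h l \<in> generate G (h' ` I)"
      proof (cases "l = j")
        case True
        have "h' i [^] (- s) \<in> generate G (h' ` I)"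
          using ij by (auto intro!: generate.incl subgroup_int_pow_closed[OF sub(2)])
        with hl have "h' l \<otimes> h' i [^] (- s) \<in> generate G (h' ` I)" by (rule generate.eng)
        moreover have "h' l \<otimes> h' i [^] (- s) = h l"
          using True ij hc by (simp add: h'_def m_assoc int_pow_mult[symmetric])
        ultimately show ?thesis by simp
      qed (use hl in \<open>simp add: h'_def\<close>)
    qed
    then have 2: "generate G (h ` I) \<subseteq> generate G (h' ` I)"
      by (rule generate_subgroup_incl[OF _ sub(2)])
    show ?thesis
      using f 1 2 by (intro exI[of _ f] exI[of _ l] conjI) simp_all
  qed
qed

text \<open>A power of \<open>s\<close> in the span of \<open>T\<close> is a relation, which would allow to save a generator.\<close>

lemma minimal_generators_independent:
  assumes tf: "\<And>x n::nat. x \<in> carrier G \<Longrightarrow> n > 0 \<Longrightarrow> x [^] n = \<one> \<Longrightarrow> x = \<one>"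
    and S: "finite S" "S \<subseteq> carrier G" "generate G S = carrier G"
    and min: "\<And>S'. finite S' \<Longrightarrow> S' \<subseteq> carrier G \<Longrightarrow> generate G S' = carrier G \<Longrightarrow> card S \<le> card S'"
    and T: "T \<subseteq> S" "s \<in> S" "s \<notin> T" and k: "s [^] (k::int) \<in> generate G T"
  shows "k = 0"
proof (rule ccontr)
  assume "k \<noteq> 0"
  have finT: "finite T" "T \<subseteq> carrier G" using T S finite_subset by auto
  obtain c :: "'a \<Rightarrow> int" where c: "s [^] k = (\<Otimes>t\<in>T. t [^] c t)"
    using generate_eq_power_products[OF finT k] by blast
  define d where "d t = (if t = s then - k else if t \<in> T then c t else 0)" for t
  have sc: "s \<in> carrier G" using S T by blast
  have "(\<Otimes>t\<in>S. t [^] d t) = (\<Otimes>t\<in>insert s T. t [^] d t)"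
    using S T by (intro finprod_mono_neutral_cong_right) (auto simp: d_def)
  also have "\<dots> = s [^] d s \<otimes> (\<Otimes>t\<in>T. t [^] d t)"
    using finT T sc by (subst finprod_insert) (auto simp: Pi_iff)
  also have "(\<Otimes>t\<in>T. t [^] d t) = s [^] k"
    unfolding c using T finT by (intro finprod_cong) (auto simp: d_def simp_implies_def)
  also have "s [^] d s \<otimes> s [^] k = \<one>" using sc by (simp add: d_def int_pow_mult[symmetric])
  finally have rel: "(\<Otimes>t\<in>S. t [^] d t) = \<one>" .
  have "\<exists>h' j. j \<in> S \<and> h' \<in> S \<rightarrow> carrier G \<and>
      generate G (h' ` (S - {j})) = generate G ((\<lambda>t. t) ` S)"
    by (rule relation_drops_generator[OF tf S(1) _ rel])
      (use S T \<open>k \<noteq> 0\<close> in \<open>auto simp: d_def\<close>)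
  then obtain h j where h: "j \<in> S" "h \<in> S \<rightarrow> carrier G" "generate G (h ` (S - {j})) = carrier G"
    using S(3) by auto
  have "card S \<le> card (h ` (S - {j}))"
    by (rule min) (use h S in auto)
  also have "\<dots> \<le> card (S - {j})" using S by (intro card_image_le) simp
  also have "\<dots> < card S" using h(1) S by (intro psubset_card_mono) auto
  finally show False by simp
qed

lemma generate_insert_elem:
  assumes "h \<in> carrier G" "T \<subseteq> carrier G" "g \<in> generate G (insert h T)"
  shows "\<exists>w\<in>generate G T. \<exists>k::int. g = w \<otimes> h [^] k"
proof -
  let ?P = "\<lambda>g. \<exists>w\<in>generate G T. \<exists>k::int. g = w \<otimes> h [^] k"
  have TC: "generate G T \<subseteq> carrier G" by (rule generate_incl[OF assms(2)])
  show ?thesis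
    using assms(3)
  proof (induction rule: generate.induct)
    case one
    have "\<one> = \<one> \<otimes> h [^] (0::int)" by simp
    then show ?case using generate.one by blast
  next
    case (incl g)
    show ?case
    proof (cases "g = h")
      case True
      then have "g = \<one> \<otimes> h [^] (1::int)" using assms by simp
      then show ?thesis using generate.one by blast
    next
      case False
      then have "g \<in> generate G T" using incl by (auto intro: generate.incl)
      moreover have "g = g \<otimes> h [^] (0::int)" using calculation TC by auto
      ultimately show ?thesis by blast
    qed
  next
    case (inv g)
    show ?case
    proof (cases "g = h")
      case True
      then have "inv g = \<one> \<otimes> h [^] (- 1::int)" using assms by (simp add: int_pow_neg)
      then show ?thesis using generate.one by blast
    next
      case False
      then have "inv g \<in> generate G T" using inv by (auto intro: generate.inv)
      moreover have "inv g = inv g \<otimes> h [^] (0::int)" using calculation TC by auto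
      ultimately show ?thesis by blast
    qed
  next
    case (eng g1 g2)
    then obtain w1 w2 k1 k2 where w: "w1 \<in> generate G T" "w2 \<in> generate G T"
      and g: "g1 = w1 \<otimes> h [^] (k1::int)" "g2 = w2 \<otimes> h [^] (k2::int)" by blast
    have "g1 \<otimes> g2 = (w1 \<otimes> w2) \<otimes> (h [^] k1 \<otimes> h [^] k2)"
      unfolding g using w TC assms(1) by (simp add: subset_iff m_ac)
    also have "\<dots> = (w1 \<otimes> w2) \<otimes> h [^] (k1 + k2)" using assms(1) by (simp add: int_pow_mult)
    finally show ?case using generate.eng[OF w] by blast
  qed
qed

end

section \<open>Iterated semidirect products over a torsion-free abelian quotient\<close>

lemma iterated_semidirect_append:
  "iterated_semidirect G M N Hs \<Longrightarrow> iterated_semidirect G K M Hs' \<Longrightarrow>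
    iterated_semidirect G K N (Hs @ Hs')"
  by (induction Hs arbitrary: N) auto

lemma iterated_semidirect_single:
  "internal_semidirect G K M H \<Longrightarrow> iterated_semidirect G K M [H]"
  by (auto simp: internal_semidirect_def)

text \<open>The partial products are the preimages of the subgroups generated by the initial segments
  of the basis. They are normal because the quotient is commutative, and independence of the
  basis makes each new cyclic factor meet the previous product trivially.\<close>

lemma iterated_semidirect_of_basis_lift:
  assumes G: "group G" and D: "subgroup D G" and C: "comm_group C"
    and f: "f \<in> hom (G\<lparr>carrier := D\<rparr>) C"
    and gs: "set gs \<subseteq> D" and gen: "generate C (f ` set gs) = carrier C"
    and indep: "\<And>i k::int. i < length gs \<Longrightarrow>
      f (gs ! i) [^]\<^bsub>C\<^esub> k \<in> generate C (f ` set (take i gs)) \<Longrightarrow> k = 0"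
  shows "iterated_semidirect G D {g \<in> D. f g = \<one>\<^bsub>C\<^esub>} (map (\<lambda>g. generate G {g}) gs)"
proof -
  interpret G: group G by (rule G)
  interpret D: subgroup D G by (rule D)
  interpret C: comm_group C by (rule C)
  let ?D = "G\<lparr>carrier := D\<rparr>"
  have gD: "group ?D" by (rule G.subgroup_imp_group[OF D])
  interpret f: group_hom ?D C f
    by (intro group_hom.intro group_hom_axioms.intro gD C.group_axioms f)
  have fC: "f g \<in> carrier C" if "g \<in> D" for g using f.hom_closed that by simp
  have f_mult: "f (g \<otimes>\<^bsub>G\<^esub> h) = f g \<otimes>\<^bsub>C\<^esub> f h" if "g \<in> D" "h \<in> D" for g h
    using f.hom_mult that by simp
  have f_inv: "f (inv\<^bsub>G\<^esub> g) = inv\<^bsub>C\<^esub> f g" if "g \<in> D" for g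
    using f.hom_inv[of g] G.m_inv_consistent[OF D that] that by simp
  have f_pow: "f (g [^]\<^bsub>G\<^esub> k) = f g [^]\<^bsub>C\<^esub> k" if "g \<in> D" for g and k :: int
    using f.hom_int_pow[of g k] G.int_pow_consistent[OF D that, of k] that by simp
  have f_one: "f \<one>\<^bsub>G\<^esub> = \<one>\<^bsub>C\<^esub>" using f.hom_one by simp
  define M where "M i = {g \<in> D. f g \<in> generate C (f ` set (take i gs))}" for i
  have seg: "f ` set (take i gs) \<subseteq> carrier C" for i
    using gs fC set_take_subset[of i gs] by blast
  have sub: "subgroup (generate C (f ` set (take i gs))) C" for i
    by (rule C.generate_is_subgroup[OF seg])
  have M: "subgroup (M i) G" for i
  proof (rule G.subgroupI)
    have "\<one>\<^bsub>G\<^esub> \<in> M i" using f_one generate.one[of C] D.one_closed by (simp add: M_def)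
    then show "M i \<noteq> {}" by blast
    show "M i \<subseteq> carrier G" using D.subset by (auto simp: M_def)
    show "inv\<^bsub>G\<^esub> g \<in> M i" if "g \<in> M i" for g
      using that f_inv subgroup.m_inv_closed[OF sub] by (auto simp: M_def)
    show "g \<otimes>\<^bsub>G\<^esub> h \<in> M i" if "g \<in> M i" "h \<in> M i" for g h
      using that f_mult generate.eng by (auto simp: M_def)
  qed
  have step: "internal_semidirect G (M (Suc i)) (M i) (generate G {gs ! i})" if i: "i < length gs" for i
  proof -
    let ?g = "gs ! i" and ?T = "f ` set (take i gs)"
    have g: "?g \<in> D" using i gs by (meson nth_mem subset_iff)
    have take: "f ` set (take (Suc i) gs) = insert (f ?g) ?T"
      using i by (simp add: take_Suc_conv_app_nth)
    have pow: "generate G {?g} = {?g [^]\<^bsub>G\<^esub> k |k::int. True}"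
      using G.generate_pow g D.subset by auto
    have le: "M i \<subseteq> M (Suc i)"
      using C.mono_generate[of ?T "insert (f ?g) ?T"] by (auto simp: M_def take)
    have "?g \<in> M (Suc i)" using g by (auto simp: M_def take intro: generate.incl)
    then have gle: "generate G {?g} \<subseteq> M (Suc i)" by (intro G.generate_subgroup_incl M) simp
    have gsub: "subgroup (generate G {?g}) G" using g D.subset by (intro G.generate_is_subgroup) auto
    have "M i \<lhd> G\<lparr>carrier := M (Suc i)\<rparr>"
    proof (rule group.normal_invI[OF G.subgroup_imp_group[OF M]])
      show "subgroup (M i) (G\<lparr>carrier := M (Suc i)\<rparr>)" by (rule G.subgroup_incl[OF M M le])
      fix x h assume x: "x \<in> carrier (G\<lparr>carrier := M (Suc i)\<rparr>)" and h: "h \<in> M i"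
      have xD: "x \<in> D" and hD: "h \<in> D" using x h by (auto simp: M_def)
      have "f (x \<otimes>\<^bsub>G\<^esub> h \<otimes>\<^bsub>G\<^esub> inv\<^bsub>G\<^esub> x) = f x \<otimes>\<^bsub>C\<^esub> f h \<otimes>\<^bsub>C\<^esub> inv\<^bsub>C\<^esub> f x"
        using xD hD by (simp add: f_mult f_inv)
      also have "\<dots> = f h" using fC[OF xD] fC[OF hD] by (simp add: C.m_comm[of "f x"] C.m_assoc)
      finally have "x \<otimes>\<^bsub>G\<^esub> h \<otimes>\<^bsub>G\<^esub> inv\<^bsub>G\<^esub> x \<in> M i"
        using h xD hD by (simp add: M_def)
      then show "x \<otimes>\<^bsub>G\<lparr>carrier := M (Suc i)\<rparr>\<^esub> h \<otimes>\<^bsub>G\<lparr>carrier := M (Suc i)\<rparr>\<^esub>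
          inv\<^bsub>G\<lparr>carrier := M (Suc i)\<rparr>\<^esub> x \<in> M i"
        using G.m_inv_consistent[OF M, of x "Suc i"] x by simp
    qed
    moreover have "M i \<inter> generate G {?g} = {\<one>\<^bsub>G\<^esub>}"
    proof
      show "M i \<inter> generate G {?g} \<subseteq> {\<one>\<^bsub>G\<^esub>}"
      proof
        fix h assume "h \<in> M i \<inter> generate G {?g}"
        then obtain k :: int where k: "h = ?g [^]\<^bsub>G\<^esub> k" "h \<in> M i" by (auto simp: pow)
        then have "k = 0" using indep[OF i] f_pow[OF g] by (simp add: M_def)
        then show "h \<in> {\<one>\<^bsub>G\<^esub>}" using k by simp
      qed
      show "{\<one>\<^bsub>G\<^esub>} \<subseteq> M i \<inter> generate G {?g}"
        using subgroup.one_closed[OF M] generate.one[of G] by simp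
    qed
    moreover have "M i <#>\<^bsub>G\<^esub> generate G {?g} = M (Suc i)"
    proof
      show "M i <#>\<^bsub>G\<^esub> generate G {?g} \<subseteq> M (Suc i)"
        using le gle subgroup.m_closed[OF M] unfolding set_mult_def by blast
      show "M (Suc i) \<subseteq> M i <#>\<^bsub>G\<^esub> generate G {?g}"
      proof
        fix h assume h: "h \<in> M (Suc i)"
        then have hD: "h \<in> D" and "f h \<in> generate C (insert (f ?g) ?T)" by (auto simp: M_def take)
        then obtain w and k :: int where w: "w \<in> generate C ?T" "f h = w \<otimes>\<^bsub>C\<^esub> f ?g [^]\<^bsub>C\<^esub> k"
          using C.generate_insert_elem[OF fC[OF g] seg] by blast
        have wc: "w \<in> carrier C" using w(1) sub subgroup.mem_carrier by metis
        have pD: "?g [^]\<^bsub>G\<^esub> (- k) \<in> D" "?g [^]\<^bsub>G\<^esub> k \<in> D"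
          by (rule G.subgroup_int_pow_closed[OF D g])+
        have "f (h \<otimes>\<^bsub>G\<^esub> ?g [^]\<^bsub>G\<^esub> (- k)) = w"
          using hD pD wc fC[OF g] by (simp add: f_mult f_pow[OF g] w(2) C.m_assoc C.int_pow_mult[symmetric])
        then have "h \<otimes>\<^bsub>G\<^esub> ?g [^]\<^bsub>G\<^esub> (- k) \<in> M i" using w(1) hD pD by (simp add: M_def)
        moreover have "h = h \<otimes>\<^bsub>G\<^esub> ?g [^]\<^bsub>G\<^esub> (- k) \<otimes>\<^bsub>G\<^esub> ?g [^]\<^bsub>G\<^esub> k"
          using hD g D.subset by (simp add: subset_iff G.m_assoc G.int_pow_mult[symmetric])
        moreover have "?g [^]\<^bsub>G\<^esub> k \<in> generate G {?g}" by (auto simp: pow)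
        ultimately show "h \<in> M i <#>\<^bsub>G\<^esub> generate G {?g}" unfolding set_mult_def by blast
      qed
    qed
    ultimately show ?thesis
      using M G.subgroup_incl[OF gsub M gle] by (simp add: internal_semidirect_def)
  qed
  have "iterated_semidirect G (M i) (M 0) (map (\<lambda>g. generate G {g}) (take i gs))"
    if "i \<le> length gs" for i
    using that
  proof (induction i)
    case 0
    then show ?case using M by simp
  next
    case (Suc i)
    then have i: "i < length gs" by simp
    show ?case
      using iterated_semidirect_append[OF Suc.IH iterated_semidirect_single[OF step[OF i]]] i
      by (simp add: take_Suc_conv_app_nth)
  qed
  from this[of "length gs"] have "iterated_semidirect G (M (length gs)) (M 0) (map (\<lambda>g. generate G {g}) gs)"
    by simp
  moreover have "M (length gs) = {g \<in> D. f g \<in> carrier C}"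
    unfolding M_def take_all[OF order_refl] gen by (rule refl)
  moreover have "{g \<in> D. f g \<in> carrier C} = D" using fC by blast
  moreover have "M 0 = {g \<in> D. f g = \<one>\<^bsub>C\<^esub>}" by (simp add: M_def C.generate_empty)
  ultimately show ?thesis by simp
qed

text \<open>In a torsion-free abelian group a generating set of minimal size is a basis, so its lifts
  satisfy the independence condition above.\<close>

theorem iterated_semidirect_over_torsion_free_abelian:
  assumes G: "group G" and D: "subgroup D G" and K: "group K"
    and f: "f \<in> hom (G\<lparr>carrier := D\<rparr>) K"
    and comm: "\<And>g h. g \<in> D \<Longrightarrow> h \<in> D \<Longrightarrow> f g \<otimes>\<^bsub>K\<^esub> f h = f h \<otimes>\<^bsub>K\<^esub> f g"
    and tf: "torsion_free K (f ` D)"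
    and fg: "\<exists>S. finite S \<and> S \<subseteq> D \<and> D = generate G S"
  shows "\<exists>gs. set gs \<subseteq> D \<and>
    iterated_semidirect G D {g \<in> D. f g = \<one>\<^bsub>K\<^esub>} (map (\<lambda>g. generate G {g}) gs) \<and>
    f ` D = generate K (f ` set gs) \<and> length gs = group_rank K (f ` D)"
proof -
  interpret G: group G by (rule G)
  interpret K: group K by (rule K)
  let ?D = "G\<lparr>carrier := D\<rparr>"
  interpret f: group_hom ?D K f
    by (intro group_hom.intro group_hom_axioms.intro G.subgroup_imp_group[OF D] K f)
  define H where "H = f ` D"
  have H: "subgroup H K" using f.img_is_subgroup by (simp add: H_def)
  define C where "C = K\<lparr>carrier := H\<rparr>"
  interpret C: comm_group C
    unfolding C_def
    by (rule group.group_comm_groupI[OF K.subgroup_imp_group[OF H]]) (use comm in \<open>auto simp: H_def\<close>)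
  have carrier_C: "carrier C = H" by (simp add: C_def)
  have genC: "generate C S = generate K S" if "S \<subseteq> H" for S
    unfolding C_def by (rule K.generate_consistent[OF that H])
  have tfC: "v = \<one>\<^bsub>C\<^esub>" if "v \<in> carrier C" "n > 0" "v [^]\<^bsub>C\<^esub> n = \<one>\<^bsub>C\<^esub>" for v and n :: nat
  proof -
    have "v [^]\<^bsub>K\<^esub> n = \<one>\<^bsub>K\<^esub>"
      using that K.nat_pow_consistent[of v n H] by (simp add: C_def)
    then show ?thesis using tf that by (auto simp: torsion_free_def C_def H_def)
  qed
  define P where "P n \<longleftrightarrow> (\<exists>S\<subseteq>H. finite S \<and> card S = n \<and> generate K S = H)" for n
  have rank: "group_rank K H = (LEAST n. P n)" by (simp add: group_rank_def P_def)
  obtain S where S: "finite S" "S \<subseteq> D" "D = generate G S" using fg by blast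
  have "generate K (f ` S) = f ` generate ?D S"
    by (rule f.generate_img) (use S in simp)
  also have "generate ?D S = D" using G.generate_consistent[OF S(2) D] S(3) by simp
  finally have "P (card (f ` S))"
    using S by (auto simp: P_def H_def intro!: exI[of _ "f ` S"])
  then have "P (group_rank K H)" unfolding rank by (rule LeastI)
  then obtain B where B: "B \<subseteq> H" "finite B" "card B = group_rank K H" "generate K B = H"
    by (auto simp: P_def)
  have minB: "card B \<le> card S'" if "finite S'" "S' \<subseteq> carrier C" "generate C S' = carrier C" for S'
  proof -
    have "P (card S')" using that genC[of S'] unfolding P_def carrier_C by metis
    then show ?thesis unfolding B(3) rank by (rule Least_le)
  qed
  obtain hs where hs: "set hs = B" "distinct hs" using finite_distinct_list[OF B(2)] by blast
  have "\<forall>h\<in>set hs. \<exists>g\<in>D. f g = h" using hs B(1) by (auto simp: H_def)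
  then obtain s where s: "\<And>h. h \<in> set hs \<Longrightarrow> s h \<in> D \<and> f (s h) = h" by metis
  define gs where "gs = map s hs"
  have fgs: "map f gs = hs" using s by (auto simp: gs_def intro: map_idI)
  have img: "f ` set (take i gs) = set (take i hs)" for i
    using fgs by (metis list.set_map take_map)
  have img': "f ` set gs = B" using fgs hs(1) by (metis list.set_map)
  have gsD: "set gs \<subseteq> D" using s by (auto simp: gs_def)
  have len: "length gs = length hs" by (simp add: gs_def)
  have "iterated_semidirect G D {g \<in> D. f g = \<one>\<^bsub>C\<^esub>} (map (\<lambda>g. generate G {g}) gs)"
  proof (rule iterated_semidirect_of_basis_lift[OF G D C.comm_group_axioms _ gsD])
    show "f \<in> hom ?D C" using f by (auto simp: hom_def C_def H_def)
    show "generate C (f ` set gs) = carrier C" using B genC by (simp add: img' carrier_C)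
  next
    fix i and k :: int
    assume i: "i < length gs" and k: "f (gs ! i) [^]\<^bsub>C\<^esub> k \<in> generate C (f ` set (take i gs))"
    have "f (gs ! i) = hs ! i" using fgs i by (metis nth_map)
    moreover have "hs ! i \<notin> set (take i hs)"
      using hs(2) i len by (auto simp: in_set_conv_nth nth_eq_iff_index_eq)
    moreover have "hs ! i \<in> B" using hs(1) i len by (metis nth_mem)
    ultimately show "k = 0"
      using C.minimal_generators_independent[of B "set (take i hs)" "hs ! i" k] tfC B minB genC[of B]
        carrier_C hs(1) i len k img set_take_subset[of i hs] by simp
  qed
  then have "iterated_semidirect G D {g \<in> D. f g = \<one>\<^bsub>K\<^esub>} (map (\<lambda>g. generate G {g}) gs)"
    by (simp add: C_def)
  moreover have "f ` D = generate K (f ` set gs)" using B(4) img' by (simp add: H_def)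
  moreover have "length gs = group_rank K (f ` D)"
    using B(3) hs(1) distinct_card[OF hs(2)] len by (simp add: H_def)
  ultimately show ?thesis using gsD by (intro exI[of _ gs] conjI)
qed

section \<open>Projective coordinates of upper triangular classes\<close>

text \<open>If the identity is isolated, then any bounded part of the group is finite: otherwise it
  would contain a sequence of distinct elements whose entries converge, and the quotients of
  consecutive terms would tend to the identity.\<close>

lemma (in triangular3_rep) triangular3_if_identity_isolated:
  assumes isolated: "\<And>k :: nat \<Rightarrow> 'a. range k \<subseteq> carrier G \<Longrightarrow>
      (\<lambda>n. a (k n)) \<longlonglongrightarrow> 1 \<Longrightarrow> (\<lambda>n. b (k n)) \<longlonglongrightarrow> 1 \<Longrightarrow> (\<lambda>n. x (k n)) \<longlonglongrightarrow> 0 \<Longrightarrow>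
      (\<lambda>n. y (k n)) \<longlonglongrightarrow> 0 \<Longrightarrow> (\<lambda>n. z (k n)) \<longlonglongrightarrow> 0 \<Longrightarrow> \<exists>n. k n = \<one>"
  shows "triangular3 G a b x y z"
proof (intro triangular3.intro triangular3_axioms.intro triangular3_rep_axioms)
  fix R
  let ?E = "{g \<in> carrier G. cmod (a g) \<le> R \<and> cmod (1 / a g) \<le> R \<and> cmod (b g) \<le> R \<and>
    cmod (1 / b g) \<le> R \<and> cmod (x g) \<le> R \<and> cmod (y g) \<le> R \<and> cmod (z g) \<le> R}"
  show "finite ?E"
  proof (rule ccontr)
    assume "infinite ?E"
    then obtain f :: "nat \<Rightarrow> 'a" where f: "inj f" "range f \<subseteq> ?E"
      using infinite_countable_subset by blast
    have fE: "f n \<in> ?E" for n using f(2) by (rule range_subsetD)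
    have fc: "f n \<in> carrier G" for n using fE[of n] by simp
    define v where "v n = (a (f n), b (f n), x (f n), y (f n), z (f n))" for n
    have "bounded (range v)"
      unfolding bounded_iff
    proof (intro exI[of _ "5 * R"] ballI)
      fix w assume "w \<in> range v"
      then obtain n where "w = v n" by blast
      then have "norm w \<le> cmod (a (f n)) + (cmod (b (f n)) + (cmod (x (f n)) +
          (cmod (y (f n)) + cmod (z (f n)))))"
        unfolding v_def by (auto intro!: order_trans[OF norm_Pair_le] add_left_mono)
      then show "norm w \<le> 5 * R" using fE[of n] by simp
    qed
    then obtain l r where r: "strict_mono r" and l: "(v \<circ> r) \<longlonglongrightarrow> l"
      using bounded_imp_convergent_subsequence by blast
    obtain la lb lx ly lz where l': "l = (la, lb, lx, ly, lz)" by (cases l) auto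
    let ?g = "\<lambda>n. f (r n)"
    have conv: "(\<lambda>n. a (?g n)) \<longlonglongrightarrow> la" "(\<lambda>n. b (?g n)) \<longlonglongrightarrow> lb" "(\<lambda>n. x (?g n)) \<longlonglongrightarrow> lx"
      "(\<lambda>n. y (?g n)) \<longlonglongrightarrow> ly" "(\<lambda>n. z (?g n)) \<longlonglongrightarrow> lz"
    proof -
      note 1 = l[unfolded l' o_def v_def]
      note 2 = tendsto_snd[OF 1, simplified]
      note 3 = tendsto_snd[OF 2, simplified]
      note 4 = tendsto_snd[OF 3, simplified]
      show "(\<lambda>n. a (?g n)) \<longlonglongrightarrow> la" using tendsto_fst[OF 1] by simp
      show "(\<lambda>n. b (?g n)) \<longlonglongrightarrow> lb" using tendsto_fst[OF 2] by simp
      show "(\<lambda>n. x (?g n)) \<longlonglongrightarrow> lx" using tendsto_fst[OF 3] by simp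
      show "(\<lambda>n. y (?g n)) \<longlonglongrightarrow> ly" using tendsto_fst[OF 4] by simp
      show "(\<lambda>n. z (?g n)) \<longlonglongrightarrow> lz" using tendsto_snd[OF 4] by simp
    qed
    have away: "L \<noteq> 0" if "u \<longlonglongrightarrow> L" "\<And>n. u n \<noteq> 0" "\<And>n. cmod (1 / u n) \<le> R" for u L
    proof
      assume "L = 0"
      have "1 \<le> R * cmod (u n)" for n
        using that(2,3)[of n] by (simp add: norm_divide field_simps)
      moreover have "(\<lambda>n. R * cmod (u n)) \<longlonglongrightarrow> R * cmod L"
        by (intro tendsto_intros that(1))
      ultimately have "1 \<le> R * cmod L" by (intro LIMSEQ_le_const) auto
      then show False using \<open>L = 0\<close> by simp
    qed
    have la: "la \<noteq> 0" by (rule away[OF conv(1)]) (use fE nonzero in auto)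
    have lb: "lb \<noteq> 0" by (rule away[OF conv(2)]) (use fE nonzero in auto)
    note conv' = conv[THEN LIMSEQ_Suc]
    define k where "k n = inv (?g n) \<otimes> ?g (Suc n)" for n
    have kc: "range k \<subseteq> carrier G" using fc by (auto simp: k_def)
    have ka: "a (k n) = a (?g (Suc n)) / a (?g n)" for n
      using fc by (simp add: k_def a_mult invs)
    have kb: "b (k n) = b (?g (Suc n)) / b (?g n)" for n
      using fc by (simp add: k_def b_mult invs)
    have kx: "x (k n) = (x (?g (Suc n)) - x (?g n) * b (?g (Suc n)) / b (?g n)) / a (?g n)" for n
      using fc nonzero[OF fc] by (simp add: k_def x_mult invs field_simps)
    have ky: "y (k n) = (y (?g (Suc n)) - y (?g n)) / b (?g n)" for n
      using fc nonzero[OF fc] by (simp add: k_def y_mult invs field_simps)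
    have kz: "z (k n) = (z (?g (Suc n)) - z (?g n) - x (?g n) * (y (?g (Suc n)) - y (?g n)) / b (?g n))
        / a (?g n)" for n
      using fc nonzero[OF fc] by (simp add: k_def z_mult invs field_simps)
    have "(\<lambda>n. a (k n)) \<longlonglongrightarrow> la / la"
      unfolding ka by (intro tendsto_intros conv conv' la)
    moreover have "(\<lambda>n. b (k n)) \<longlonglongrightarrow> lb / lb"
      unfolding kb by (intro tendsto_intros conv conv' lb)
    moreover have "(\<lambda>n. x (k n)) \<longlonglongrightarrow> (lx - lx * lb / lb) / la"
      unfolding kx by (intro tendsto_intros conv conv' la lb)
    moreover have "(\<lambda>n. y (k n)) \<longlonglongrightarrow> (ly - ly) / lb"
      unfolding ky by (intro tendsto_intros conv conv' lb)
    moreover have "(\<lambda>n. z (k n)) \<longlonglongrightarrow> (lz - lz - lx * (ly - ly) / lb) / la"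
      unfolding kz by (intro tendsto_intros conv conv' la lb)
    ultimately have "\<exists>n. k n = \<one>" using la lb by (intro isolated kc) simp_all
    then obtain n where "inv (?g n) \<otimes> ?g (Suc n) = \<one>" by (auto simp: k_def)
    then have "?g n = ?g (Suc n)"
      using fc by (metis inv_closed inv_equality inv_inv)
    then have "r n = r (Suc n)" using f(1) by (simp add: inj_eq)
    then show False using strict_monoD[OF r, of n "Suc n"] by simp
  qed
qed

definition entry :: "3 \<Rightarrow> 3 \<Rightarrow> (complex^3^3) set \<Rightarrow> complex" where
  "entry i j g = the_elem ((\<lambda>A. A$i$j / A$3$3) ` g)"

definition upper :: "(complex^3^3) set" where
  "upper = {A \<in> carrier SL. A$2$1 = 0 \<and> A$3$1 = 0 \<and> A$3$2 = 0}"

lemma U_plusE: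
  assumes "g \<in> U_plus"
  obtains A where "A \<in> upper" "g = SL_scalars #>\<^bsub>SL\<^esub> A"
  using assms unfolding U_plus_def upper_def by blast

lemma entry_coset: "entry i j (SL_scalars #>\<^bsub>SL\<^esub> A) = A$i$j / A$3$3"
  unfolding entry_def by (rule the_elem_coset) (simp add: mat_mult_component)

lemma upper_SL: "A \<in> upper \<Longrightarrow> A \<in> carrier SL"
  by (simp add: upper_def)

lemma upper_diag: "A \<in> upper \<Longrightarrow> A$1$1 * A$2$2 * A$3$3 = 1"
  by (auto simp: upper_def SL_def det_3)

lemma upper_nonzero:
  assumes "A \<in> upper"
  shows "A$1$1 \<noteq> 0" "A$2$2 \<noteq> 0" "A$3$3 \<noteq> 0"
  using upper_diag[OF assms] by auto

lemma coset_mult: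
  assumes "A \<in> carrier SL" "B \<in> carrier SL"
  shows "(SL_scalars #>\<^bsub>SL\<^esub> A) \<otimes>\<^bsub>PSL\<^esub> (SL_scalars #>\<^bsub>SL\<^esub> B) = SL_scalars #>\<^bsub>SL\<^esub> (A ** B)"
  using normal.rcos_sum[OF normal_SL_scalars assms] by (simp add: PSL_def SL_def)

lemma SL_carrier: "A \<in> carrier SL \<longleftrightarrow> det A = 1"
  by (simp add: SL_def)

lemma PSL_one: "\<one>\<^bsub>PSL\<^esub> = SL_scalars"
  by (simp add: PSL_def FactGroup_def)

lemma coset_one: "SL_scalars #>\<^bsub>SL\<^esub> mat 1 = (SL_scalars :: (complex^'n^'n) set)"
proof -
  interpret group "SL :: (complex^'n^'n) monoid" by (rule group_SL)
  have "SL_scalars \<subseteq> carrier (SL :: (complex^'n^'n) monoid)" by (auto simp: SL_scalars_def)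
  from coset_mult_one[OF this] show ?thesis by (simp add: SL_def)
qed

lemma coset_scale:
  fixes A :: "complex^'n^'n"
  assumes "A \<in> carrier SL" "mat c ** A \<in> carrier SL"
  shows "SL_scalars #>\<^bsub>SL\<^esub> (mat c ** A) = SL_scalars #>\<^bsub>SL\<^esub> A"
proof -
  interpret group "SL :: (complex^'n^'n) monoid" by (rule group_SL)
  have "det (mat c :: complex^'n^'n) = 1" using assms by (simp add: SL_def det_mul)
  then have "mat c \<in> (SL_scalars :: (complex^'n^'n) set)" by (auto simp: SL_scalars_def SL_def)
  then have "mat c ** A \<in> SL_scalars #>\<^bsub>SL\<^esub> A" unfolding coset_SL_scalars by blast
  then show ?thesis
    by (rule repr_independence[symmetric])
      (use assms(1) normal_imp_subgroup[OF normal_SL_scalars] in auto)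
qed

definition upper_matrix :: "complex \<Rightarrow> complex \<Rightarrow> complex \<Rightarrow> complex \<Rightarrow> complex \<Rightarrow> complex \<Rightarrow> complex^3^3" where
  "upper_matrix c a b x y z =
     vector [vector [c * a, c * x, c * z], vector [0, c * b, c * y], vector [0, 0, c]]"

lemma upper_matrix_coset:
  assumes g: "g \<in> U_plus" and c: "c ^ 3 * (entry 1 1 g * entry 2 2 g) = 1"
  defines "B \<equiv> upper_matrix c (entry 1 1 g) (entry 2 2 g) (entry 1 2 g) (entry 2 3 g) (entry 1 3 g)"
  shows "B \<in> carrier SL" "g = SL_scalars #>\<^bsub>SL\<^esub> B"
proof -
  obtain A where A: "A \<in> upper" "g = SL_scalars #>\<^bsub>SL\<^esub> A" using g by (rule U_plusE)
  have "det B = c ^ 3 * (entry 1 1 g * entry 2 2 g)"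
    by (simp add: B_def upper_matrix_def det_3 power3_eq_cube algebra_simps)
  then show B: "B \<in> carrier SL" using c by (simp add: SL_def)
  have "B = mat (c / A$3$3) ** A"
    using upper_nonzero[OF A(1)] A(1)
    by (simp add: vec_eq_iff forall_3 mat_mult_component B_def upper_matrix_def A(2) entry_coset upper_def)
  then show "g = SL_scalars #>\<^bsub>SL\<^esub> B"
    using coset_scale[OF upper_SL[OF A(1)], of "c / A$3$3"] B A(2) by simp
qed

text \<open>The matrices with lower right entry \<open>1\<close> have determinants tending to \<open>1\<close>, so they can be
  scaled by cube roots tending to \<open>1\<close>. This turns convergence of the normalized entries into
  convergence in \<open>SL\<close>, where the preimage of an isolating neighbourhood is open.\<close>

lemma identity_isolated:
  assumes discrete: "subtopology PSL_topology \<Gamma> = discrete_topology \<Gamma>" and one: "\<one>\<^bsub>PSL\<^esub> \<in> \<Gamma>"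
    and U: "\<Gamma> \<subseteq> U_plus" and k: "range k \<subseteq> \<Gamma>"
    and lim: "(\<lambda>n. entry 1 1 (k n)) \<longlonglongrightarrow> 1" "(\<lambda>n. entry 2 2 (k n)) \<longlonglongrightarrow> 1"
      "(\<lambda>n. entry 1 2 (k n)) \<longlonglongrightarrow> 0" "(\<lambda>n. entry 2 3 (k n)) \<longlonglongrightarrow> 0" "(\<lambda>n. entry 1 3 (k n)) \<longlonglongrightarrow> 0"
  shows "\<exists>n :: nat. k n = \<one>\<^bsub>PSL\<^esub>"
proof -
  have "openin (subtopology PSL_topology \<Gamma>) {\<one>\<^bsub>PSL\<^esub>}" using one by (simp add: discrete)
  then obtain V where V: "openin PSL_topology V" "{\<one>\<^bsub>PSL\<^esub>} = V \<inter> \<Gamma>"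
    by (auto simp: openin_subtopology)
  have "continuous_map (top_of_set (carrier SL)) PSL_topology (\<lambda>A. SL_scalars #>\<^bsub>SL\<^esub> (A :: complex^3^3))"
    unfolding PSL_topology_def by (intro quotient_imp_continuous_map quotient_map_quotient_topology)
  from openin_continuous_map_preimage[OF this V(1)]
  obtain T where T: "open T" "{A \<in> carrier SL. SL_scalars #>\<^bsub>SL\<^esub> (A :: complex^3^3) \<in> V} = carrier SL \<inter> T"
    by (auto simp: openin_open)
  have "mat 1 \<in> {A \<in> carrier SL. SL_scalars #>\<^bsub>SL\<^esub> (A :: complex^3^3) \<in> V}"
    using V(2) by (auto simp: coset_one PSL_one SL_carrier)
  then have T1: "mat 1 \<in> T" using T(2) by blast
  define c where "c n = exp (- Ln (entry 1 1 (k n) * entry 2 2 (k n)) / 3)" for n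
  define B where "B n = upper_matrix (c n) (entry 1 1 (k n)) (entry 2 2 (k n)) (entry 1 2 (k n))
    (entry 2 3 (k n)) (entry 1 3 (k n))" for n
  have kU: "k n \<in> U_plus" for n using k U by blast
  have nz: "entry 1 1 (k n) * entry 2 2 (k n) \<noteq> 0" for n
    using kU[of n] by (elim U_plusE) (simp add: entry_coset upper_nonzero)
  have "c n ^ 3 * (entry 1 1 (k n) * entry 2 2 (k n)) = 1" for n
  proof -
    have "c n ^ 3 = exp (- Ln (entry 1 1 (k n) * entry 2 2 (k n)))"
      by (simp add: c_def exp_of_nat_mult[symmetric])
    then show ?thesis using nz[of n] by (simp add: exp_minus field_simps)
  qed
  from upper_matrix_coset[OF kU this]
  have B: "B n \<in> carrier SL" "k n = SL_scalars #>\<^bsub>SL\<^esub> B n" for n by (simp_all add: B_def)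
  have "(\<lambda>n. entry 1 1 (k n) * entry 2 2 (k n)) \<longlonglongrightarrow> 1 * 1" by (intro tendsto_mult lim)
  then have "(\<lambda>n. Ln (entry 1 1 (k n) * entry 2 2 (k n))) \<longlonglongrightarrow> Ln 1"
    by (intro tendsto_Ln) (simp_all add: complex_nonpos_Reals_iff)
  then have "(\<lambda>n. exp (- Ln (entry 1 1 (k n) * entry 2 2 (k n)) / 3)) \<longlonglongrightarrow> exp (- Ln 1 / 3)"
    by (intro tendsto_exp tendsto_divide tendsto_minus tendsto_const) simp_all
  then have c: "c \<longlonglongrightarrow> 1" by (simp add: c_def[abs_def])
  have "B \<longlonglongrightarrow> mat 1"
  proof (intro vec_tendstoI)
    fix i j :: 3
    have ij: "i \<in> {1, 2, 3}" "j \<in> {1, 2, 3}" using UNIV_3 by auto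
    note l = tendsto_mult[OF c lim(1)] tendsto_mult[OF c lim(2)] tendsto_mult[OF c lim(3)]
      tendsto_mult[OF c lim(4)] tendsto_mult[OF c lim(5)] c
    show "(\<lambda>n. B n $ i $ j) \<longlonglongrightarrow> mat 1 $ i $ j"
      using ij l by (auto simp: B_def upper_matrix_def mat_def)
  qed
  then have "eventually (\<lambda>n. B n \<in> T) sequentially" using T(1) T1 by (rule topological_tendstoD)
  then obtain n where "B n \<in> T" using eventually_happens by force
  then have "B n \<in> {A \<in> carrier SL. SL_scalars #>\<^bsub>SL\<^esub> (A :: complex^3^3) \<in> V}"
    using B(1) T(2) by blast
  then have "k n \<in> V \<inter> \<Gamma>" using B(2) k by auto
  then show ?thesis using V(2) by blast
qed

lemma upper_mult:
  assumes A: "A \<in> upper" and B: "B \<in> upper"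
  shows "(A ** B)$1$1 = A$1$1 * B$1$1" "(A ** B)$2$2 = A$2$2 * B$2$2" "(A ** B)$3$3 = A$3$3 * B$3$3"
    "(A ** B)$1$2 = A$1$1 * B$1$2 + A$1$2 * B$2$2"
    "(A ** B)$2$3 = A$2$2 * B$2$3 + A$2$3 * B$3$3"
    "(A ** B)$1$3 = A$1$1 * B$1$3 + A$1$2 * B$2$3 + A$1$3 * B$3$3"
  using assms by (simp_all add: matrix_matrix_mult_def sum_3 upper_def)

lemma triangular3_discrete_subgroup:
  assumes \<Gamma>: "subgroup \<Gamma> PSL" and discrete: "subtopology PSL_topology \<Gamma> = discrete_topology \<Gamma>"
    and U: "\<Gamma> \<subseteq> U_plus"
  shows "triangular3 (PSL\<lparr>carrier := \<Gamma>\<rparr>) (entry 1 1) (entry 2 2) (entry 1 2) (entry 2 3) (entry 1 3)"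
proof (rule triangular3_rep.triangular3_if_identity_isolated)
  have gr: "group (PSL\<lparr>carrier := \<Gamma>\<rparr>)" by (rule group.subgroup_imp_group[OF group_PSL \<Gamma>])
  have mult: "entry 1 1 (g \<otimes>\<^bsub>PSL\<^esub> h) = entry 1 1 g * entry 1 1 h \<and>
      entry 2 2 (g \<otimes>\<^bsub>PSL\<^esub> h) = entry 2 2 g * entry 2 2 h \<and>
      entry 1 2 (g \<otimes>\<^bsub>PSL\<^esub> h) = entry 1 1 g * entry 1 2 h + entry 1 2 g * entry 2 2 h \<and>
      entry 2 3 (g \<otimes>\<^bsub>PSL\<^esub> h) = entry 2 2 g * entry 2 3 h + entry 2 3 g \<and>
      entry 1 3 (g \<otimes>\<^bsub>PSL\<^esub> h) = entry 1 1 g * entry 1 3 h + entry 1 2 g * entry 2 3 h + entry 1 3 g"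
    if gh: "g \<in> \<Gamma>" "h \<in> \<Gamma>" for g h
  proof -
    obtain A where A: "A \<in> upper" "g = SL_scalars #>\<^bsub>SL\<^esub> A" using gh U by (meson U_plusE subsetD)
    obtain B where B: "B \<in> upper" "h = SL_scalars #>\<^bsub>SL\<^esub> B" using gh U by (meson U_plusE subsetD)
    note nz = upper_nonzero[OF A(1)] upper_nonzero[OF B(1)]
    show ?thesis
      unfolding A(2) B(2) coset_mult[OF upper_SL[OF A(1)] upper_SL[OF B(1)]] entry_coset
        upper_mult[OF A(1) B(1)]
      using nz by (simp add: field_simps)
  qed
  show "triangular3_rep (PSL\<lparr>carrier := \<Gamma>\<rparr>) (entry 1 1) (entry 2 2) (entry 1 2) (entry 2 3) (entry 1 3)"
  proof (intro triangular3_rep.intro triangular3_rep_axioms.intro gr)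
    fix g assume "g \<in> carrier (PSL\<lparr>carrier := \<Gamma>\<rparr>)"
    then have "g \<in> U_plus" using U by auto
    then show "entry 1 1 g \<noteq> 0 \<and> entry 2 2 g \<noteq> 0"
      by (elim U_plusE) (simp add: entry_coset upper_nonzero)
  qed (use mult in simp_all)
next
  fix k :: "nat \<Rightarrow> (complex^3^3) set"
  assume "range k \<subseteq> carrier (PSL\<lparr>carrier := \<Gamma>\<rparr>)"
    and "(\<lambda>n. entry 1 1 (k n)) \<longlonglongrightarrow> 1" "(\<lambda>n. entry 2 2 (k n)) \<longlonglongrightarrow> 1" "(\<lambda>n. entry 1 2 (k n)) \<longlonglongrightarrow> 0"
      "(\<lambda>n. entry 2 3 (k n)) \<longlonglongrightarrow> 0" "(\<lambda>n. entry 1 3 (k n)) \<longlonglongrightarrow> 0"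
  then have "\<exists>n. k n = \<one>\<^bsub>PSL\<^esub>"
    by (intro identity_isolated[OF discrete subgroup.one_closed[OF \<Gamma>] U]) simp_all
  then show "\<exists>n. k n = \<one>\<^bsub>PSL\<lparr>carrier := \<Gamma>\<rparr>\<^esub>" by simp
qed

section \<open>The decomposition\<close>

lemma group_Cstar: "group Cstar"
proof (rule groupI)
  fix v assume "v \<in> carrier Cstar"
  then show "\<exists>w\<in>carrier Cstar. w \<otimes>\<^bsub>Cstar\<^esub> v = \<one>\<^bsub>Cstar\<^esub>"
    by (intro bexI[of _ "inverse v"]) (auto simp: Cstar_def)
qed (auto simp: Cstar_def)

definition shear :: "complex \<Rightarrow> complex^2^2" where
  "shear w = vector [vector [1, w], vector [0, 1]]"

lemma shear_SL: "shear w \<in> carrier SL"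
  by (simp add: SL_carrier shear_def det_2)

lemma shear_coset_mult:
  "(SL_scalars #>\<^bsub>SL\<^esub> shear v) \<otimes>\<^bsub>PSL\<^esub> (SL_scalars #>\<^bsub>SL\<^esub> shear w) = SL_scalars #>\<^bsub>SL\<^esub> shear (v + w)"
proof -
  have "shear v ** shear w = shear (v + w)"
    by (simp add: vec_eq_iff forall_2 shear_def matrix_matrix_mult_def sum_2 add.commute)
  then show ?thesis by (simp add: coset_mult shear_SL)
qed

lemma shear_coset_eq_one_iff: "SL_scalars #>\<^bsub>SL\<^esub> shear w = \<one>\<^bsub>PSL\<^esub> \<longleftrightarrow> w = 0"
proof
  assume "SL_scalars #>\<^bsub>SL\<^esub> shear w = \<one>\<^bsub>PSL\<^esub>"
  then have "shear w \<in> SL_scalars"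
    using group.rcos_self[OF group_SL shear_SL normal_imp_subgroup[OF normal_SL_scalars], of w]
    by (simp add: PSL_one)
  then obtain c where "shear w = mat c" by (auto simp: SL_scalars_def)
  then have "shear w $ 1 $ 2 = (mat c :: complex^2^2) $ 1 $ 2" by simp
  then show "w = 0" by (simp add: shear_def mat_def)
next
  assume "w = 0"
  then have "shear w = mat 1" by (simp add: vec_eq_iff forall_2 shear_def mat_def)
  then show "SL_scalars #>\<^bsub>SL\<^esub> shear w = \<one>\<^bsub>PSL\<^esub>" by (simp add: coset_one PSL_one)
qed

lemma shear_coset_pow:
  "(SL_scalars #>\<^bsub>SL\<^esub> shear w) [^]\<^bsub>PSL\<^esub> (n::nat) = SL_scalars #>\<^bsub>SL\<^esub> shear (of_nat n * w)"
proof (induction n)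
  case 0
  then show ?case using shear_coset_eq_one_iff[of 0] by (simp add: nat_pow_def)
next
  case (Suc n)
  then show ?case
    using monoid.nat_pow_Suc[OF group.is_monoid[OF group_PSL], of "SL_scalars #>\<^bsub>SL\<^esub> shear w" n]
    by (simp add: shear_coset_mult algebra_simps)
qed

lemma block_hom_unipotent:
  assumes "g \<in> U_plus" "lambda23 g = 1"
  shows "block_hom g = SL_scalars #>\<^bsub>SL\<^esub> shear (entry 2 3 g)"
proof -
  obtain A where A: "A \<in> upper" "g = SL_scalars #>\<^bsub>SL\<^esub> A" using assms(1) by (rule U_plusE)
  note nz = upper_nonzero[OF A(1)]
  have "A$2$2 = A$3$3" using assms(2) nz by (simp add: A(2) lambda23_coset)
  then have "lower_right_block A = mat (A$3$3) ** shear (entry 2 3 g)"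
    using nz A(1)
    by (simp add: vec_eq_iff forall_2 mat_mult_component lower_right_block_def shear_def A(2)
        entry_coset upper_def)
  then have "block_hom g = PSL_class (shear (entry 2 3 g))"
    unfolding A(2) block_hom_coset by (simp add: PSL_class_scale nz)
  then show ?thesis by (simp add: PSL_class_SL shear_SL)
qed

theorem theorem2p22:
  fixes \<Gamma> :: "(complex^3^3) set set"
  assumes "complex_kleinian \<Gamma>"
    and "\<Gamma> \<subseteq> U_plus"
    and "\<not> comm_group (PSL\<lparr>carrier := \<Gamma>\<rparr>)"
    and "torsion_free PSL \<Gamma>"
    and "torsion_free Cstar (lambda12 ` \<Gamma>)"
    and "torsion_free Cstar (lambda23 ` \<Gamma>)"
  shows "\<exists>\<xi>s \<eta>s \<gamma>s.
    set \<xi>s \<union> set \<eta>s \<union> set \<gamma>s \<subseteq> \<Gamma> \<and>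
    iterated_semidirect PSL \<Gamma> (Core \<Gamma>) (map (\<lambda>g. generate PSL {g}) (\<xi>s @ \<eta>s @ \<gamma>s)) \<and>
    lambda23 ` \<Gamma> = generate Cstar (lambda23 ` set \<gamma>s) \<and>
    length \<gamma>s = group_rank Cstar (lambda23 ` \<Gamma>) \<and>
    lambda12 ` Ker23 \<Gamma> = generate Cstar (lambda12 ` set \<eta>s) \<and>
    length \<eta>s = group_rank Cstar (lambda12 ` Ker23 \<Gamma>) \<and>
    block_hom ` (Ker12 \<Gamma> \<inter> Ker23 \<Gamma>) = generate PSL (block_hom ` set \<xi>s) \<and>
    length \<xi>s = group_rank PSL (block_hom ` (Ker12 \<Gamma> \<inter> Ker23 \<Gamma>))"
proof -
  have \<Gamma>: "subgroup \<Gamma> PSL" and discrete: "subtopology PSL_topology \<Gamma> = discrete_topology \<Gamma>"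
    using assms(1) by (auto simp: complex_kleinian_def)
  let ?G = "PSL\<lparr>carrier := \<Gamma>\<rparr>"
  interpret P: group "PSL :: (complex^3^3) set monoid" by (rule group_PSL)
  interpret \<Gamma>: subgroup \<Gamma> PSL by (rule \<Gamma>)
  interpret T: triangular3 ?G "entry 1 1" "entry 2 2" "entry 1 2" "entry 2 3" "entry 1 3"
    by (rule triangular3_discrete_subgroup[OF \<Gamma> discrete assms(2)])
  have lam12: "lambda12 g = entry 1 1 g / entry 2 2 g" and lam23: "lambda23 g = entry 2 2 g"
    if "g \<in> \<Gamma>" for g
  proof -
    have "g \<in> U_plus" using that assms(2) by blast
    then obtain A where A: "A \<in> upper" "g = SL_scalars #>\<^bsub>SL\<^esub> A" by (rule U_plusE)
    show "lambda12 g = entry 1 1 g / entry 2 2 g" "lambda23 g = entry 2 2 g"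
      using upper_nonzero[OF A(1)] by (simp_all add: A(2) entry_coset lambda12_coset lambda23_coset)
  qed
  have fg: "\<exists>S. finite S \<and> S \<subseteq> D \<and> D = generate PSL S" if D: "subgroup D PSL" "D \<subseteq> \<Gamma>" for D
  proof -
    have "subgroup D ?G" by (rule P.subgroup_incl[OF D(1) \<Gamma> D(2)])
    from T.noetherian_over_trivial[OF T.noetherian this]
    obtain S where S: "finite S" "S \<subseteq> D" "D = generate ?G S" using D(2) by auto
    have "D = generate PSL S"
      using S(3) unfolding P.generate_consistent[OF subset_trans[OF S(2) D(2)] \<Gamma>] .
    with S(1,2) show ?thesis by (intro exI[of _ S] conjI)
  qed
  have nz: "entry 1 1 g \<noteq> 0" "entry 2 2 g \<noteq> 0" if "g \<in> \<Gamma>" for g using T.nonzero that by auto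
  have mult: "entry 1 1 (g \<otimes>\<^bsub>PSL\<^esub> h) = entry 1 1 g * entry 1 1 h"
    "entry 2 2 (g \<otimes>\<^bsub>PSL\<^esub> h) = entry 2 2 g * entry 2 2 h"
    "entry 2 3 (g \<otimes>\<^bsub>PSL\<^esub> h) = entry 2 2 g * entry 2 3 h + entry 2 3 g"
    if "g \<in> \<Gamma>" "h \<in> \<Gamma>" for g h
    using T.a_mult[of g h] T.b_mult[of g h] T.y_mult[of g h] that by simp_all
  have hom23: "lambda23 \<in> hom ?G Cstar"
    by (rule homI) (simp_all add: lam23 mult nz Cstar_def)
  have K23: "Ker23 \<Gamma> = {g \<in> \<Gamma>. lambda23 g = \<one>\<^bsub>Cstar\<^esub>}" by (simp add: Ker23_def kernel_def)
  have K12: "Ker12 \<Gamma> = {g \<in> \<Gamma>. lambda12 g = \<one>\<^bsub>Cstar\<^esub>}" by (simp add: Ker12_def kernel_def)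
  have one: "\<one>\<^bsub>Cstar\<^esub> = 1" by (simp add: Cstar_def)
  have K23_\<Gamma>: "Ker23 \<Gamma> \<subseteq> \<Gamma>" by (auto simp: K23)
  have subK23: "subgroup (Ker23 \<Gamma>) PSL"
  proof -
    interpret f: group_hom ?G Cstar lambda23
      by (intro group_hom.intro group_hom_axioms.intro T.group_axioms group_Cstar hom23)
    show ?thesis
      unfolding Ker23_def by (rule P.incl_subgroup[OF \<Gamma> f.subgroup_kernel])
  qed
  have hom12: "lambda12 \<in> hom (PSL\<lparr>carrier := Ker23 \<Gamma>\<rparr>) Cstar"
  proof (rule homI)
    fix g h assume "g \<in> carrier (PSL\<lparr>carrier := Ker23 \<Gamma>\<rparr>)" "h \<in> carrier (PSL\<lparr>carrier := Ker23 \<Gamma>\<rparr>)"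
    then have "g \<in> \<Gamma>" "h \<in> \<Gamma>" using K23_\<Gamma> by auto
    then show "lambda12 (g \<otimes>\<^bsub>PSL\<lparr>carrier := Ker23 \<Gamma>\<rparr>\<^esub> h) = lambda12 g \<otimes>\<^bsub>Cstar\<^esub> lambda12 h"
      by (simp add: lam12 mult Cstar_def)
  qed (use K23_\<Gamma> in \<open>auto simp: lam12 nz Cstar_def\<close>)
  let ?U = "Ker12 \<Gamma> \<inter> Ker23 \<Gamma>"
  have U_eq: "{g \<in> Ker23 \<Gamma>. lambda12 g = \<one>\<^bsub>Cstar\<^esub>} = ?U" using K23_\<Gamma> by (auto simp: K12)
  have U_unip: "?U = T.unip"
    using nz by (auto simp: K12 K23 T.unip_def lam12 lam23 one)
  have subU: "subgroup ?U PSL"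
    unfolding U_unip by (rule P.incl_subgroup[OF \<Gamma> T.subgroup_unip])
  have U\<Gamma>: "?U \<subseteq> \<Gamma>" using K23_\<Gamma> by blast
  have block: "block_hom g = SL_scalars #>\<^bsub>SL\<^esub> shear (entry 2 3 g)" if "g \<in> ?U" for g
    by (rule block_hom_unipotent) (use that assms(2) in \<open>auto simp: K23 one\<close>)
  have block_mult: "block_hom (g \<otimes>\<^bsub>PSL\<^esub> h) = block_hom g \<otimes>\<^bsub>PSL\<^esub> block_hom h"
    and block_comm: "block_hom g \<otimes>\<^bsub>PSL\<^esub> block_hom h = block_hom h \<otimes>\<^bsub>PSL\<^esub> block_hom g"
    if gh: "g \<in> ?U" "h \<in> ?U" for g h
  proof -
    have "entry 2 2 g = 1" using gh U_unip by (auto simp: T.unip_def)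
    then have "entry 2 3 (g \<otimes>\<^bsub>PSL\<^esub> h) = entry 2 3 g + entry 2 3 h"
      using gh U\<Gamma> by (subst mult(3)) auto
    then show "block_hom (g \<otimes>\<^bsub>PSL\<^esub> h) = block_hom g \<otimes>\<^bsub>PSL\<^esub> block_hom h"
      using block[OF subgroup.m_closed[OF subU gh]] by (simp only: block[OF gh(1)] block[OF gh(2)] shear_coset_mult)
    show "block_hom g \<otimes>\<^bsub>PSL\<^esub> block_hom h = block_hom h \<otimes>\<^bsub>PSL\<^esub> block_hom g"
      by (simp only: block[OF gh(1)] block[OF gh(2)] shear_coset_mult add.commute)
  qed
  have hom_block: "block_hom \<in> hom (PSL\<lparr>carrier := ?U\<rparr>) PSL"
  proof (rule homI)
    fix g assume "g \<in> carrier (PSL\<lparr>carrier := ?U\<rparr>)"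
    then have "block_hom g = SL_scalars #>\<^bsub>SL\<^esub> shear (entry 2 3 g)" by (intro block) simp
    then show "block_hom g \<in> carrier PSL"
      using shear_SL by (simp add: PSL_def carrier_FactGroup)
  qed (simp add: block_mult)
  have tf_block: "torsion_free PSL (block_hom ` ?U)"
    unfolding torsion_free_def
  proof (intro ballI allI impI)
    fix v and n :: nat assume "v \<in> block_hom ` ?U" and n: "0 < n \<and> v [^]\<^bsub>PSL\<^esub> n = \<one>\<^bsub>PSL\<^esub>"
    then obtain g where "v = SL_scalars #>\<^bsub>SL\<^esub> shear (entry 2 3 g)" using block by auto
    then show "v = \<one>\<^bsub>PSL\<^esub>" using n by (auto simp: shear_coset_pow shear_coset_eq_one_iff)
  qed
  have Core: "Core \<Gamma> = {g \<in> ?U. block_hom g = \<one>\<^bsub>PSL\<^esub>}"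
    using K23_\<Gamma> by (auto simp: Core_def KerBlock_def kernel_def)
  have Cstar_comm: "v \<otimes>\<^bsub>Cstar\<^esub> w = w \<otimes>\<^bsub>Cstar\<^esub> v" for v w by (simp add: Cstar_def)
  have "\<exists>\<gamma>s. set \<gamma>s \<subseteq> \<Gamma> \<and>
      iterated_semidirect PSL \<Gamma> {g \<in> \<Gamma>. lambda23 g = \<one>\<^bsub>Cstar\<^esub>} (map (\<lambda>g. generate PSL {g}) \<gamma>s) \<and>
      lambda23 ` \<Gamma> = generate Cstar (lambda23 ` set \<gamma>s) \<and>
      length \<gamma>s = group_rank Cstar (lambda23 ` \<Gamma>)"
    by (rule iterated_semidirect_over_torsion_free_abelian[OF group_PSL \<Gamma> group_Cstar hom23
        _ assms(6) fg[OF \<Gamma> order_refl]]) (rule Cstar_comm)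
  then obtain \<gamma>s where \<gamma>: "set \<gamma>s \<subseteq> \<Gamma>"
      "iterated_semidirect PSL \<Gamma> (Ker23 \<Gamma>) (map (\<lambda>g. generate PSL {g}) \<gamma>s)"
      "lambda23 ` \<Gamma> = generate Cstar (lambda23 ` set \<gamma>s)"
      "length \<gamma>s = group_rank Cstar (lambda23 ` \<Gamma>)"
    unfolding K23[symmetric] by (elim exE conjE)
  have tf12: "torsion_free Cstar (lambda12 ` Ker23 \<Gamma>)"
    using assms(5) K23_\<Gamma> unfolding torsion_free_def by blast
  have "\<exists>\<eta>s. set \<eta>s \<subseteq> Ker23 \<Gamma> \<and>
      iterated_semidirect PSL (Ker23 \<Gamma>) {g \<in> Ker23 \<Gamma>. lambda12 g = \<one>\<^bsub>Cstar\<^esub>}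
        (map (\<lambda>g. generate PSL {g}) \<eta>s) \<and>
      lambda12 ` Ker23 \<Gamma> = generate Cstar (lambda12 ` set \<eta>s) \<and>
      length \<eta>s = group_rank Cstar (lambda12 ` Ker23 \<Gamma>)"
    by (rule iterated_semidirect_over_torsion_free_abelian[OF group_PSL subK23 group_Cstar hom12
        _ tf12 fg[OF subK23 K23_\<Gamma>]]) (rule Cstar_comm)
  then obtain \<eta>s where \<eta>: "set \<eta>s \<subseteq> Ker23 \<Gamma>"
      "iterated_semidirect PSL (Ker23 \<Gamma>) ?U (map (\<lambda>g. generate PSL {g}) \<eta>s)"
      "lambda12 ` Ker23 \<Gamma> = generate Cstar (lambda12 ` set \<eta>s)"
      "length \<eta>s = group_rank Cstar (lambda12 ` Ker23 \<Gamma>)"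
    unfolding U_eq by (elim exE conjE)
  have "\<exists>\<xi>s. set \<xi>s \<subseteq> ?U \<and>
      iterated_semidirect PSL ?U {g \<in> ?U. block_hom g = \<one>\<^bsub>PSL\<^esub>} (map (\<lambda>g. generate PSL {g}) \<xi>s) \<and>
      block_hom ` ?U = generate PSL (block_hom ` set \<xi>s) \<and>
      length \<xi>s = group_rank PSL (block_hom ` ?U)"
    by (rule iterated_semidirect_over_torsion_free_abelian[OF group_PSL subU group_PSL hom_block
        _ tf_block fg[OF subU U\<Gamma>]]) (rule block_comm)
  then obtain \<xi>s where \<xi>: "set \<xi>s \<subseteq> ?U"
      "iterated_semidirect PSL ?U (Core \<Gamma>) (map (\<lambda>g. generate PSL {g}) \<xi>s)"
      "block_hom ` ?U = generate PSL (block_hom ` set \<xi>s)"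
      "length \<xi>s = group_rank PSL (block_hom ` ?U)"
    unfolding Core[symmetric] by (elim exE conjE)
  have "iterated_semidirect PSL \<Gamma> (Core \<Gamma>) (map (\<lambda>g. generate PSL {g}) (\<xi>s @ \<eta>s @ \<gamma>s))"
    unfolding map_append
    by (rule iterated_semidirect_append[OF \<xi>(2) iterated_semidirect_append[OF \<eta>(2) \<gamma>(2)]])
  moreover have "set \<xi>s \<union> set \<eta>s \<union> set \<gamma>s \<subseteq> \<Gamma>" using \<xi>(1) \<eta>(1) \<gamma>(1) K23_\<Gamma> by blast
  ultimately show ?thesis
    using \<xi>(3,4) \<eta>(3,4) \<gamma>(3,4) by (intro exI[of _ \<xi>s] exI[of _ \<eta>s] exI[of _ \<gamma>s] conjI)
qed

end
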